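(* Let $M,N\ge 1$ be integers, let $\beta_{\mathrm d},\beta_{\mathrm{br}},\beta_{\mathrm{ru}},\bar\tau>0$, and let $\mathrm{SNR}$ be the optimal uplink SNR of the RIS-aided link defined in the context, with correlated Rayleigh UE-BS and UE-RIS channels (correlation matrices $\mathbf R_{\mathrm d}$, $\mathbf R_{\mathrm{ru}}$) and a rank-1 LOS RIS-BS channel. Then $$\mathbb E\{\mathrm{SNR}\}=\left(\beta_{\mathrm d}M+\frac{NA\pi\sqrt{\beta_{\mathrm d}\beta_{\mathrm{br}}\beta_{\mathrm{ru}}}}{2}+\beta_{\mathrm{br}}\beta_{\mathrm{ru}}M(N+F)\right)\bar\tau,$$ where $A=\lVert\mathbf R_{\mathrm d}^{1/2}\mathbf a_{\mathrm b}\rVert_2$, $\rho_{ij}=(\mathbf R_{\mathrm{ru}})_{ij}$, and $$F=\sum_{i=1}^{N}\sum_{\substack{j=1\\ j\ne i}}^{N}\frac{\pi}{4}\left(1-|\rho_{ij}|^2\right)^2\,{}_2F_1\!\left(\tfrac32,\tfrac32;1;|\rho_{ij}|^2\right),$$ with ${}_2F_1$ the Gaussian hypergeometric function.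
   Context: Channel model. $\mathbf R_{\mathrm d}\in\mathbb C^{M\times M}$ and $\mathbf R_{\mathrm{ru}}\in\mathbb C^{N\times N}$ are correlation matrices (Hermitian positive semidefinite with unit diagonal), and $\mathbf R^{1/2}$ denotes the Hermitian positive semidefinite square root. $\mathbf u_{\mathrm d}\sim\mathcal{CN}(\mathbf 0,\mathbf I_M)$ and $\mathbf u_{\mathrm{ru}}\sim\mathcal{CN}(\mathbf 0,\mathbf I_N)$ are independent standard circularly symmetric complex Gaussian vectors (each entry has $\mathbb E|u|^2=1$). The UE-BS channel is $\mathbf h_{\mathrm d}=\sqrt{\beta_{\mathrm d}}\,\mathbf R_{\mathrm d}^{1/2}\mathbf u_{\mathrm d}$; the UE-RIS channel is $\mathbf h_{\mathrm{ru}}=\sqrt{\beta_{\mathrm{ru}}}\,\tilde{\mathbf h}_{\mathrm{ru}}$ with $\tilde{\mathbf h}_{\mathrm{ru}}=\mathbf R_{\mathrm{ru}}^{1/2}\mathbf u_{\mathrm{ru}}$. The RIS-BS channel is $\mathbf H_{\mathrm{br}}=\sqrt{\beta_{\mathrm{br}}}\,\mathbf a_{\mathrm b}\mathbf a_{\mathrm r}^H$, where the steering vectors $\mathbf a_{\mathrm b}\in\mathbb C^M$, $\mathbf a_{\mathrm r}\in\mathbb C^N$ are deterministic with all entries of modulus 1 (so $\lVert\mathbf a_{\mathrm b}\rVert_2^2=M$). It is assumed that $\mathbf R_{\mathrm d}^{1/2}\mathbf a_{\mathrm b}\neq\mathbf 0$, so that $\mathbf a_{\mathrm b}^H\mathbf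 h_{\mathrm d}\ne0$ almost surely. Optimal SNR. The global uplink channel is $\mathbf h=\mathbf h_{\mathrm d}+\mathbf H_{\mathrm{br}}\boldsymbol\Phi\mathbf h_{\mathrm{ru}}$ with the SNR-maximising RIS phase matrix $$\boldsymbol\Phi=\psi\,\mathrm{diag}\{e^{j\angle\mathbf a_{\mathrm r}}\}\,\mathrm{diag}\{e^{-j\angle\mathbf h_{\mathrm{ru}}}\},\qquad \psi=\frac{\mathbf a_{\mathrm b}^H\mathbf h_{\mathrm d}}{|\mathbf a_{\mathrm b}^H\mathbf h_{\mathrm d}|},$$ where angles and exponentials of vectors are taken entrywise. Hence $\mathbf h=\mathbf h_{\mathrm d}+\alpha\,\mathbf a_{\mathrm b}$ with $\alpha=\sqrt{\beta_{\mathrm{br}}\beta_{\mathrm{ru}}}\,\psi\,Y$ and $Y=\sum_{n=1}^N|\tilde h_{\mathrm{ru},n}|$, and the optimal uplink SNR is $$\mathrm{SNR}=\mathbf h^H\mathbf h\,\bar\tau=(\mathbf h_{\mathrm d}^H+\alpha^*\mathbf a_{\mathrm b}^H)(\mathbf h_{\mathrm d}+\alpha\,\mathbf a_{\mathrm b})\,\bar\tau.$$ Convention: when $|\rho_{ij}|=1$, the expression $(1-x)^2{}_2F_1(\frac32,\frac32;1;x)$ at $x=1$ is understood as its limit as $x\to1^-$. *)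

theory Defs
  imports "HOL-Probability.Probability"
begin

section \<open>Complex vectors and matrices\<close>

text \<open>The scalar \<open>x\<^sup>H y\<close>: conjugate-linear in the first argument. The library's inner product on
  \<open>complex ^ 'n\<close> is its real part.\<close>

definition herm_dot :: "complex ^ 'n \<Rightarrow> complex ^ 'n \<Rightarrow> complex" where
  "herm_dot x y = (\<Sum>i\<in>UNIV. cnj (x $ i) * y $ i)"

definition herm_outer :: "complex ^ 'm \<Rightarrow> complex ^ 'n \<Rightarrow> complex ^ 'n ^ 'm" where
  "herm_outer x y = (\<chi> i j. x $ i * cnj (y $ j))"

definition hermitian :: "complex ^ 'n ^ 'n \<Rightarrow> bool" where
  "hermitian A \<longleftrightarrow> (\<forall>i j. A $ i $ j = cnj (A $ j $ i))"

definition herm_psd :: "complex ^ 'n ^ 'n \<Rightarrow> bool" where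
  "herm_psd A \<longleftrightarrow> hermitian A \<and> (\<forall>x. 0 \<le> Re (herm_dot x (A *v x)))"

definition correlation_matrix :: "complex ^ 'n ^ 'n \<Rightarrow> bool" where
  "correlation_matrix R \<longleftrightarrow> herm_psd R \<and> (\<forall>i. R $ i $ i = 1)"

definition psd_sqrt :: "complex ^ 'n ^ 'n \<Rightarrow> complex ^ 'n ^ 'n" where
  "psd_sqrt R = (THE S. herm_psd S \<and> S ** S = R)"

definition diag_mat :: "complex ^ 'n \<Rightarrow> complex ^ 'n ^ 'n" where
  "diag_mat v = (\<chi> i j. if i = j then v $ i else 0)"


section \<open>Standard circularly symmetric complex Gaussian vectors\<close>

text \<open>\<open>CN(0, I)\<close>: all real and imaginary parts of the entries are jointly independent and
  \<open>N(0, 1/2)\<close>-distributed, so that each entry has second absolute moment 1. The second argument of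
  \<^const>\<open>normal_density\<close> is the standard deviation.\<close>

definition std_complex_gaussian :: "'a measure \<Rightarrow> ('a \<Rightarrow> complex ^ 'n) \<Rightarrow> bool" where
  "std_complex_gaussian P u \<longleftrightarrow>
     prob_space.indep_vars P (\<lambda>_. borel)
       (\<lambda>(i, b) \<omega>. if b then Im (u \<omega> $ i) else Re (u \<omega> $ i)) (UNIV :: ('n \<times> bool) set) \<and>
     (\<forall>i. distributed P lborel (\<lambda>\<omega>. Re (u \<omega> $ i)) (normal_density 0 (sqrt (1 / 2))) \<and>
          distributed P lborel (\<lambda>\<omega>. Im (u \<omega> $ i)) (normal_density 0 (sqrt (1 / 2))))"

text \<open>Independence of two random vectors of possibly different dimension
  (\<^const>\<open>prob_space.indep_var\<close> requires equal value types).\<close>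

definition indep_vectors ::
  "'a measure \<Rightarrow> ('a \<Rightarrow> complex ^ 'm) \<Rightarrow> ('a \<Rightarrow> complex ^ 'n) \<Rightarrow> bool" where
  "indep_vectors P u v \<longleftrightarrow>
     prob_space.indep_set P {u -` B \<inter> space P | B. B \<in> sets borel}
                            {v -` B \<inter> space P | B. B \<in> sets borel}"


section \<open>Channels and SNR\<close>

definition rayleigh_channel :: "real \<Rightarrow> complex ^ 'n ^ 'n \<Rightarrow> complex ^ 'n \<Rightarrow> complex ^ 'n" where
  "rayleigh_channel \<beta> R u = sqrt \<beta> *\<^sub>R (psd_sqrt R *v u)"

definition los_channel :: "real \<Rightarrow> complex ^ 'm \<Rightarrow> complex ^ 'n \<Rightarrow> complex ^ 'n ^ 'm" where
  "los_channel \<beta> a_b a_r = sqrt \<beta> *\<^sub>R herm_outer a_b a_r"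

definition ris_phase ::
  "complex ^ 'm \<Rightarrow> complex ^ 'n \<Rightarrow> complex ^ 'm \<Rightarrow> complex ^ 'n \<Rightarrow> complex ^ 'n ^ 'n" where
  "ris_phase a_b a_r h_d h_ru =
     (let \<psi> = herm_dot a_b h_d / complex_of_real (cmod (herm_dot a_b h_d))
      in mat \<psi> ** diag_mat (\<chi> n. cis (Arg (a_r $ n))) ** diag_mat (\<chi> n. cis (- Arg (h_ru $ n))))"

definition global_channel ::
  "complex ^ 'm \<Rightarrow> complex ^ 'n ^ 'm \<Rightarrow> complex ^ 'n ^ 'n \<Rightarrow> complex ^ 'n \<Rightarrow> complex ^ 'm" where
  "global_channel h_d H_br \<Phi> h_ru = h_d + (H_br ** \<Phi>) *v h_ru"

definition optimal_snr ::
  "real \<Rightarrow> real \<Rightarrow> real \<Rightarrow> real \<Rightarrow> complex ^ 'm ^ 'm \<Rightarrow> complex ^ 'n ^ 'n \<Rightarrow>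
   complex ^ 'm \<Rightarrow> complex ^ 'n \<Rightarrow> complex ^ 'm \<Rightarrow> complex ^ 'n \<Rightarrow> real" where
  "optimal_snr \<beta>_d \<beta>_br \<beta>_ru \<tau> R_d R_ru a_b a_r u_d u_ru =
     (let h_d = rayleigh_channel \<beta>_d R_d u_d;
          h_ru = rayleigh_channel \<beta>_ru R_ru u_ru;
          h = global_channel h_d (los_channel \<beta>_br a_b a_r) (ris_phase a_b a_r h_d h_ru) h_ru
      in Re (herm_dot h h) * \<tau>)"


section \<open>The hypergeometric term\<close>

definition hyp2f1 :: "real \<Rightarrow> real \<Rightarrow> real \<Rightarrow> real \<Rightarrow> real" where
  "hyp2f1 a b c x = eval_fps (fps_hypergeo [a, b] [c] 1) x"

text \<open>\<open>(1 - x)\<^sup>2 \<^sub>2F\<^sub>1(3/2, 3/2; 1; x)\<close>, extended to \<open>x = 1\<close> by its left limit: the series itself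
  diverges there.\<close>

definition hyp_term :: "real \<Rightarrow> real" where
  "hyp_term x =
     (let g = (\<lambda>y. (1 - y)\<^sup>2 * hyp2f1 (3 / 2) (3 / 2) 1 y)
      in if x = 1 then Lim (at_left 1) g else g x)"

end

theory Submission
  imports Defs "HOL-Real_Asymp.Real_Asymp"
begin

text \<open>With the optimal phases, \<open>h\<^sup>Hh = |h\<^sub>d|\<^sup>2 + 2 r Y |a\<^sub>b\<^sup>H h\<^sub>d| + r\<^sup>2 Y\<^sup>2 M\<close> almost surely, where \<open>r\<close> is
  the gain of the reflected path, so everything reduces to \<open>E |w|\<close> and \<open>E |w| |w'|\<close> for linear forms
  \<open>w, w'\<close> of a complex Gaussian vector. Both follow from the joint Laplace transform of
  \<open>|w|\<^sup>2, |w'|\<^sup>2\<close> and from \<open>\<surd>\<pi> |w| = \<integral>\<^sub>0\<^sup>\<infinity> (1 - exp (-r\<^sup>2|w|\<^sup>2)) / r\<^sup>2 dr\<close>: expanding the transform into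
  a geometric series in \<open>|\<rho>|\<^sup>2\<close> makes the double integral factorise term by term, which gives
  \<open>E |w| |w'| = \<pi>/4 \<Sum>\<^sub>k ((-1/2)\<^sub>k / k!)\<^sup>2 |\<rho>|\<^bsup>2k\<^esup>\<close>, also for \<open>|\<rho>| = 1\<close>. The correlation structure enters
  only through \<open>S\<^sup>2 = R\<close> for the positive semidefinite root \<open>S\<close> of \<open>R\<close>.\<close>

section \<open>Positive semidefinite square roots\<close>

text \<open>Characteristic functions of linear forms exist in every case, and the joint Laplace
  transform is obtained from them by writing each exp (-s|w|^2) as an average of exponentials of
  linear forms over an independent copy of one Gaussian entry. The integral formula for the modulus
  has a nonnegative integrand, so every exchange of integrals and sums is done with nonnegative
  integrals, and integrability of the products comes out together with their values. The
  coefficients found this way belong to 2F1(-1/2, -1/2; 1), whereas the statement uses 2F1(3/2, 3/2;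
  1), whose series diverges at 1; Euler's transformation links the two and also gives meaning to the
  limit at 1. A separate obstacle is that \<open>psd_sqrt\<close> is a definite description: nothing
  can be said about it before existence and uniqueness of the root are proved.\<close>

text \<open>A maximiser of the quadratic form on the compact unit sphere of \<open>V\<close> is an
  eigenvector, since otherwise moving it along the residual \<open>f v - \<mu> v\<close> would
  increase the form to first order. The invariant subspace \<open>V\<close> is a parameter so that
  the lemma applies to an orthogonal complement.\<close>

lemma selfadjoint_eigenvector:
  fixes f :: "'a::euclidean_space \<Rightarrow> 'a"
  assumes lin: "linear f" and sa: "\<And>x y. f x \<bullet> y = x \<bullet> f y"
    and V: "subspace V" "\<And>x. x \<in> V \<Longrightarrow> f x \<in> V" "V \<noteq> {0}"
  obtains v \<mu> where "v \<in> V" "norm v = 1" "f v = \<mu> *\<^sub>R v"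
proof -
  interpret f: linear f by (rule lin)
  obtain x where x: "x \<in> V" "x \<noteq> 0"
    using V(1,3) subspace_0 by blast
  define K where "K = sphere 0 1 \<inter> V"
  have "compact K"
    unfolding K_def using closed_subspace[OF V(1)] by (intro compact_Int_closed) auto
  moreover have "x /\<^sub>R norm x \<in> K"
    using x V(1) by (auto simp: K_def subspace_scale)
  moreover have "continuous_on K (\<lambda>x. x \<bullet> f x)"
    using lin by (intro continuous_intros linear_continuous_on) (simp add: linear_conv_bounded_linear)
  ultimately obtain v where v: "v \<in> K" "\<And>y. y \<in> K \<Longrightarrow> y \<bullet> f y \<le> v \<bullet> f v"
    using continuous_attains_sup[of K "\<lambda>x. x \<bullet> f x"] by (metis empty_iff)
  define \<mu> where "\<mu> = v \<bullet> f v"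
  have vV: "v \<in> V" and nv: "norm v = 1" and vv: "v \<bullet> v = 1"
    using v(1) by (auto simp: K_def dot_square_norm)
  have le: "y \<bullet> f y \<le> \<mu> * (y \<bullet> y)" if "y \<in> V" for y
  proof (cases "y = 0")
    case False
    have "y /\<^sub>R norm y \<in> K"
      using False that V(1) by (auto simp: K_def subspace_scale)
    from v(2)[OF this] have "(y \<bullet> f y) / (norm y)\<^sup>2 \<le> \<mu>"
      by (simp add: f.scaleR \<mu>_def power2_eq_square divide_inverse ac_simps)
    with False show ?thesis
      by (simp add: field_simps dot_square_norm)
  qed (simp add: f.zero)
  define w where "w = f v - \<mu> *\<^sub>R v"
  have wV: "w \<in> V"
    using V vV by (auto simp: w_def subspace_diff subspace_scale)
  have wv: "w \<bullet> v = 0"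
    using vv by (simp add: w_def \<mu>_def inner_diff_left inner_commute[of "f v"])
  have wfv: "w \<bullet> f v = w \<bullet> w"
    using wv by (simp add: w_def inner_diff_right)
  \<comment> \<open>Perturbation of the maximiser along the residual: the left side is linear in
    \<open>t\<close> and the right side quadratic, so a small positive \<open>t\<close> forces
    \<open>w = 0\<close>.\<close>
  have bound: "2 * t * (w \<bullet> w) \<le> t\<^sup>2 * (\<mu> * (w \<bullet> w) - w \<bullet> f w)" for t
  proof -
    have "(v + t *\<^sub>R w) \<bullet> f (v + t *\<^sub>R w) \<le> \<mu> * ((v + t *\<^sub>R w) \<bullet> (v + t *\<^sub>R w))"
      using vV wV V(1) by (intro le) (auto simp: subspace_add subspace_scale)
    moreover have "v \<bullet> f w = w \<bullet> w"
      using wfv sa[of v w] by (simp add: inner_commute)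
    ultimately show ?thesis
      using wv wfv vv
      by (simp add: f.add f.scaleR inner_add_left inner_add_right inner_commute[of v w] \<mu>_def[symmetric]
          power2_eq_square algebra_simps)
  qed
  have "w \<bullet> w = 0"
  proof (rule ccontr)
    \<comment> \<open>The summand 1 keeps \<open>b\<close> positive. With
      \<open>t = (w \<bullet> w) / b\<close> the upper bound becomes
      \<open>t * (w \<bullet> w)\<close>, half of the quantity that it bounds.\<close>
    define b where "b = \<bar>\<mu> * (w \<bullet> w) - w \<bullet> f w\<bar> + 1"
    assume "w \<bullet> w \<noteq> 0"
    then have pos: "w \<bullet> w > 0" by simp
    have b: "b > 0" by (simp add: b_def)
    define t where "t = (w \<bullet> w) / b"
    have t: "t > 0" using pos b by (simp add: t_def)
    have "2 * t * (w \<bullet> w) \<le> t\<^sup>2 * b"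
      by (rule order_trans[OF bound]) (auto simp: b_def intro!: mult_left_mono)
    also have "\<dots> = t * (w \<bullet> w)"
      using b by (simp add: t_def power2_eq_square)
    finally show False using t pos by simp
  qed
  then have "f v = \<mu> *\<^sub>R v" by (simp add: w_def)
  with vV nv show ?thesis by (rule that)
qed

text \<open>An orthonormal set of eigenvectors of greatest cardinality exists because orthogonal
  unit vectors are independent. Its orthogonal complement is invariant under \<open>f\<close>, hence
  zero, since an eigenvector in it would enlarge the set.\<close>

lemma selfadjoint_eigenbasis:
  fixes f :: "'a::euclidean_space \<Rightarrow> 'a"
  assumes lin: "linear f" and sa: "\<And>x y. f x \<bullet> y = x \<bullet> f y"
  obtains B \<mu> where "finite B" "\<And>b. b \<in> B \<Longrightarrow> norm b = 1" "pairwise orthogonal B"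
    "\<And>b. b \<in> B \<Longrightarrow> f b = \<mu> b *\<^sub>R b" "\<And>x. x = (\<Sum>b\<in>B. (b \<bullet> x) *\<^sub>R b)"
proof -
  define eig where "eig B \<longleftrightarrow> pairwise orthogonal B \<and> (\<forall>b\<in>B. norm b = 1 \<and> (\<exists>m. f b = m *\<^sub>R b))" for B
  have indep: "finite B \<and> card B \<le> DIM('a)" if "eig B" for B
    using that independent_bound pairwise_orthogonal_independent[of B] unfolding eig_def by force
  have "eig {}" by (auto simp: eig_def)
  then obtain B where B: "eig B" and mx: "\<And>C. eig C \<Longrightarrow> card C \<le> card B"
    using ex_has_greatest_nat[of eig "{}" card "Suc (DIM('a))"] indep by (metis (mono_tags) less_Suc_eq_le)
  from B indep have fin: "finite B" by blast
  from B have unit: "\<And>b. b \<in> B \<Longrightarrow> norm b = 1" and orth: "pairwise orthogonal B"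
    by (auto simp: eig_def)
  from B obtain \<mu> where \<mu>: "\<And>b. b \<in> B \<Longrightarrow> f b = \<mu> b *\<^sub>R b"
    unfolding eig_def by metis
  define V where "V = {x. \<forall>b\<in>B. b \<bullet> x = 0}"
  have V: "subspace V" by (auto simp: V_def subspace_def inner_add_right)
  have fV: "f x \<in> V" if "x \<in> V" for x
    using that \<mu> by (auto simp: V_def simp flip: sa)
  have "V = {0}"
  proof (rule ccontr)
    assume "V \<noteq> {0}"
    from selfadjoint_eigenvector[OF lin sa V fV this] obtain v m
      where v: "v \<in> V" "norm v = 1" "f v = m *\<^sub>R v" by blast
    have "v \<notin> B"
    proof
      assume "v \<in> B"
      with v(1) have "v \<bullet> v = 0" by (auto simp: V_def)
      with v(2) show False by simp
    qed
    moreover have "eig (insert v B)"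
      using B v by (auto simp: eig_def V_def pairwise_insert orthogonal_def inner_commute)
    ultimately show False using mx fin by force
  qed
  have "x = (\<Sum>b\<in>B. (b \<bullet> x) *\<^sub>R b)" for x
  proof -
    have "c \<bullet> (\<Sum>b\<in>B. (b \<bullet> x) *\<^sub>R b) = c \<bullet> x" if "c \<in> B" for c
    proof -
      have "c \<bullet> (\<Sum>b\<in>B. (b \<bullet> x) *\<^sub>R b) = (\<Sum>b\<in>B. if b = c then c \<bullet> x else 0)"
        unfolding inner_sum_right using orth unit that
        by (intro sum.cong) (auto simp: pairwise_def orthogonal_def dot_square_norm)
      with that fin show ?thesis by simp
    qed
    then have "x - (\<Sum>b\<in>B. (b \<bullet> x) *\<^sub>R b) \<in> V" by (auto simp: V_def inner_diff_right)
    with \<open>V = {0}\<close> show ?thesis by simp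
  qed
  with fin unit orth \<mu> show ?thesis by (rule that)
qed

text \<open>In an eigenbasis the quadratic form is a sum of nonnegative terms
  \<open>\<mu> b * (b \<bullet> x)\<^sup>2\<close>, and each vanishing term kills the matching
  coefficient of \<open>f x\<close>.\<close>

lemma positive_inner_eq_0D:
  fixes f :: "'a::euclidean_space \<Rightarrow> 'a"
  assumes lin: "linear f" and sa: "\<And>x y. f x \<bullet> y = x \<bullet> f y" and pos: "\<And>x. 0 \<le> x \<bullet> f x"
    and x: "x \<bullet> f x = 0"
  shows "f x = 0"
proof -
  interpret f: linear f by (rule lin)
  obtain B \<mu> where B: "finite B" "\<And>b. b \<in> B \<Longrightarrow> norm b = 1" "pairwise orthogonal B"
    and \<mu>: "\<And>b. b \<in> B \<Longrightarrow> f b = \<mu> b *\<^sub>R b" and xB: "\<And>x. x = (\<Sum>b\<in>B. (b \<bullet> x) *\<^sub>R b)"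
    by (rule selfadjoint_eigenbasis[OF lin sa]) blast
  have nn: "\<mu> b \<ge> 0" if "b \<in> B" for b
    using pos[of b] \<mu>[OF that] B(2)[OF that] by (simp add: dot_square_norm)
  have fx: "f x = (\<Sum>b\<in>B. (\<mu> b * (b \<bullet> x)) *\<^sub>R b)"
    by (subst xB[of x]) (simp add: f.sum f.scaleR \<mu> mult.commute)
  have "(\<Sum>b\<in>B. \<mu> b * (b \<bullet> x)\<^sup>2) = 0"
    using x unfolding fx by (simp add: inner_sum_right power2_eq_square inner_commute mult.assoc)
  then have "\<forall>b\<in>B. \<mu> b * (b \<bullet> x) = 0"
    using B(1) nn by (subst (asm) sum_nonneg_eq_0_iff) auto
  then show ?thesis unfolding fx by (intro sum.neutral) auto
qed

text \<open>The two roots are not known to commute, so they cannot be diagonalised together;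
  diagonalising their difference is enough. The lemma serves twice: for complex linearity of the
  root and for the uniqueness behind \<open>psd_sqrt\<close>.\<close>

lemma positive_sqrt_unique:
  fixes f g :: "'a::euclidean_space \<Rightarrow> 'a"
  assumes f: "linear f" "\<And>x y. f x \<bullet> y = x \<bullet> f y" "\<And>x. 0 \<le> x \<bullet> f x"
    and g: "linear g" "\<And>x y. g x \<bullet> y = x \<bullet> g y" "\<And>x. 0 \<le> x \<bullet> g x"
    and eq: "\<And>x. f (f x) = g (g x)"
  shows "f = g"
proof -
  interpret f: linear f by (rule f)
  interpret g: linear g by (rule g)
  define D where "D x = f x - g x" for x
  have linD: "linear D" unfolding D_def by (intro linear_compose_sub f g)
  interpret D: linear D by (rule linD)
  have saD: "D x \<bullet> y = x \<bullet> D y" for x y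
    by (simp add: D_def inner_diff_left inner_diff_right f(2) g(2))
  obtain B \<mu> where B: "finite B" "\<And>b. b \<in> B \<Longrightarrow> norm b = 1"
    and \<mu>: "\<And>b. b \<in> B \<Longrightarrow> D b = \<mu> b *\<^sub>R b" and xB: "\<And>x. x = (\<Sum>b\<in>B. (b \<bullet> x) *\<^sub>R b)"
    by (rule selfadjoint_eigenbasis[OF linD saD]) blast
  have D0: "D b = 0" if b: "b \<in> B" for b
  proof (rule ccontr)
    assume "D b \<noteq> 0"
    with \<mu>[OF b] have nz: "\<mu> b \<noteq> 0" by auto
    \<comment> \<open>\<open>f D + D g = f\<^sup>2 - g\<^sup>2 = 0\<close>, tested on an eigenvector of \<open>D\<close>.\<close>
    have "b \<bullet> f (D b) + D b \<bullet> g b = 0"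
      by (simp add: saD) (simp add: D_def f.diff eq flip: inner_add_right)
    then have "\<mu> b * (b \<bullet> f b + b \<bullet> g b) = 0"
      by (simp add: \<mu>[OF b] f.scaleR distrib_left)
    with nz f(3)[of b] g(3)[of b] have "b \<bullet> f b = 0" "b \<bullet> g b = 0" by auto
    then have "D b = 0"
      using positive_inner_eq_0D[of f b] positive_inner_eq_0D[of g b] f g by (simp add: D_def)
    with \<open>D b \<noteq> 0\<close> show False by simp
  qed
  have "D x = 0" for x
    by (subst xB[of x]) (simp add: D.sum D.scaleR D0)
  then show ?thesis by (auto simp: D_def)
qed

lemma positive_sqrt_exists:
  fixes f :: "'a::euclidean_space \<Rightarrow> 'a"
  assumes lin: "linear f" and sa: "\<And>x y. f x \<bullet> y = x \<bullet> f y" and pos: "\<And>x. 0 \<le> x \<bullet> f x"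
  obtains g where "linear g" "\<And>x y. g x \<bullet> y = x \<bullet> g y" "\<And>x. 0 \<le> x \<bullet> g x" "\<And>x. g (g x) = f x"
proof -
  interpret f: linear f by (rule lin)
  obtain B \<mu> where B: "finite B" "\<And>b. b \<in> B \<Longrightarrow> norm b = 1" "pairwise orthogonal B"
    and \<mu>: "\<And>b. b \<in> B \<Longrightarrow> f b = \<mu> b *\<^sub>R b" and xB: "\<And>x. x = (\<Sum>b\<in>B. (b \<bullet> x) *\<^sub>R b)"
    by (rule selfadjoint_eigenbasis[OF lin sa]) blast
  have nn: "\<mu> b \<ge> 0" if "b \<in> B" for b
    using pos[of b] \<mu>[OF that] B(2)[OF that] by (simp add: dot_square_norm)
  define g where "g x = (\<Sum>b\<in>B. (sqrt (\<mu> b) * (b \<bullet> x)) *\<^sub>R b)" for x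
  have lg: "linear g"
    by (rule linearI) (simp_all add: g_def inner_add_right distrib_left scaleR_add_left sum.distrib
      scaleR_sum_right ac_simps)
  interpret g: linear g by (rule lg)
  have gb: "g b = sqrt (\<mu> b) *\<^sub>R b" if "b \<in> B" for b
  proof -
    have "g b = (\<Sum>c\<in>B. if c = b then sqrt (\<mu> b) *\<^sub>R b else 0)"
      unfolding g_def using that B(2,3)
      by (intro sum.cong) (auto simp: pairwise_def orthogonal_def dot_square_norm)
    with that B(1) show ?thesis by simp
  qed
  show ?thesis
  proof (rule that[of g])
    show "g x \<bullet> y = x \<bullet> g y" for x y
      by (auto simp: g_def inner_sum_left inner_sum_right inner_commute[of _ x] intro!: sum.cong)
    show "0 \<le> x \<bullet> g x" for x
      using nn by (auto simp: g_def inner_sum_right inner_commute mult.assoc intro!: sum_nonneg)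
    show "g (g x) = f x" for x
    proof -
      have "g (g x) = (\<Sum>b\<in>B. (sqrt (\<mu> b) * (b \<bullet> x)) *\<^sub>R g b)"
        by (subst (2) g_def) (simp add: g.sum g.scaleR)
      also have "\<dots> = (\<Sum>b\<in>B. (b \<bullet> x) *\<^sub>R f b)"
        using nn by (intro sum.cong) (auto simp: gb \<mu> mult.assoc mult.left_commute)
      also have "\<dots> = f x"
        by (subst (2) xB[of x]) (simp add: f.sum f.scaleR)
      finally show ?thesis .
    qed
  qed (rule lg)
qed

section \<open>The Hermitian form, and complex matrices as operators on a real Euclidean
  space\<close>

lemma inner_eq_Re_herm_dot: "x \<bullet> y = Re (herm_dot x y)"
  by (simp add: inner_vec_def herm_dot_def inner_complex_def)

lemma herm_dot_scale_left: "herm_dot (c *s x) y = cnj c * herm_dot x y"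
  and herm_dot_scale_right: "herm_dot x (c *s y) = c * herm_dot x y"
  and herm_dot_scaleR_left: "herm_dot (r *\<^sub>R x) y = r *\<^sub>R herm_dot x y"
  and herm_dot_scaleR_right: "herm_dot x (r *\<^sub>R y) = r *\<^sub>R herm_dot x y"
  and cnj_herm_dot: "cnj (herm_dot x y) = herm_dot y x"
  by (simp_all add: herm_dot_def sum_distrib_left scaleR_sum_right ac_simps)

lemma herm_dot_self: "herm_dot x x = complex_of_real ((norm x)\<^sup>2)"
proof -
  have "Im (herm_dot x x) = 0"
    by (simp add: herm_dot_def)
  then show ?thesis
    by (simp add: complex_eq_iff flip: inner_eq_Re_herm_dot dot_square_norm)
qed

lemma herm_dot_adjoint:
  assumes "hermitian S"
  shows "herm_dot (S *v x) y = herm_dot x (S *v y)"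
proof -
  have S: "cnj (S $ i $ j) = S $ j $ i" for i j
    using assms unfolding hermitian_def by metis
  have "herm_dot (S *v x) y = (\<Sum>i\<in>UNIV. \<Sum>j\<in>UNIV. cnj (x $ j) * (S $ j $ i * y $ i))"
    by (simp add: herm_dot_def matrix_vector_mult_def sum_distrib_right S mult.assoc mult.left_commute)
  also have "\<dots> = (\<Sum>j\<in>UNIV. \<Sum>i\<in>UNIV. cnj (x $ j) * (S $ j $ i * y $ i))"
    by (rule sum.swap)
  also have "\<dots> = herm_dot x (S *v y)"
    by (simp add: herm_dot_def matrix_vector_mult_def sum_distrib_left)
  finally show ?thesis .
qed

lemma vector_scalar_scaleR: "c *s (r *\<^sub>R x) = r *\<^sub>R (c *s x)" for x :: "complex^'n"
  by (simp add: vec_eq_iff)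

lemma matrix_scaleR_vector_mult: "(A::complex^'n^'m) *v (r *\<^sub>R x) = r *\<^sub>R (A *v x)"
  by (simp add: matrix_vector_mult_def vec_eq_iff scaleR_sum_right)

lemma linear_complex_matrix: "linear ((*v) (A::complex^'n^'m))"
  by (rule linearI) (simp_all add: matrix_vector_right_distrib matrix_scaleR_vector_mult)

lemma herm_psd_operator:
  assumes "herm_psd S"
  shows "(S *v x) \<bullet> y = x \<bullet> (S *v y)" "0 \<le> x \<bullet> (S *v x)"
  using assms by (auto simp: herm_psd_def inner_eq_Re_herm_dot herm_dot_adjoint)

lemma herm_dot_axis: "herm_dot (axis i 1) x = x $ i"
  by (simp add: herm_dot_def axis_def if_distrib[of cnj] if_distrib[of "\<lambda>a. a * _"] cong: if_cong)

lemma matrix_vector_mult_axis: "((A::complex^'n^'m) *v axis k 1) $ i = A $ i $ k"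
  by (simp add: matrix_vector_mult_def axis_def if_distrib[of "\<lambda>a. _ * a"] cong: if_cong)

text \<open>The root is built for the real inner product Re (x^H y), which gives only a real linear
  map. Complex linearity has to be recovered before the map can be represented by a complex
  matrix.\<close>

lemma psd_sqrt_works:
  fixes R :: "complex ^ 'n ^ 'n"
  assumes R: "herm_psd R"
  shows "herm_psd (psd_sqrt R)" "psd_sqrt R ** psd_sqrt R = R"
proof -
  obtain g where g: "linear g" "\<And>x y. g x \<bullet> y = x \<bullet> g y" "\<And>x. 0 \<le> x \<bullet> g x"
    and gg: "\<And>x. g (g x) = R *v x"
    using positive_sqrt_exists[OF linear_complex_matrix herm_psd_operator[OF R]] by metis
  interpret g: linear g by (rule g)
  \<comment> \<open>Conjugating \<open>g\<close> by multiplication with \<open>\<i>\<close> yields another positive root, so \<open>g\<close> is complex linear.\<close>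
  define h where "h x = (-\<i>) *s g (\<i> *s x)" for x
  have "h = g"
  proof (rule positive_sqrt_unique)
    show "linear h"
    proof (rule linearI)
      show "h (r *\<^sub>R x) = r *\<^sub>R h x" for r x
        unfolding h_def by (simp only: g.scaleR vector_scalar_scaleR)
      show "h (x + y) = h x + h y" for x y
        by (simp only: h_def vector_add_ldistrib g.add)
    qed
    have *: "((-\<i>) *s x) \<bullet> y = x \<bullet> (\<i> *s y)" "(\<i> *s x) \<bullet> y = x \<bullet> ((-\<i>) *s y)" for x y :: "complex^'n"
      by (simp_all only: inner_eq_Re_herm_dot herm_dot_scale_left herm_dot_scale_right) simp_all
    show "h x \<bullet> y = x \<bullet> h y" for x y
      by (simp only: h_def * g(2))
    show "0 \<le> x \<bullet> h x" for x
      using g(3)[of "\<i> *s x"] by (simp only: h_def *)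
    show "h (h x) = g (g x)" for x
    proof -
      have "\<i> *s ((-\<i>) *s y) = y" "(-\<i>) *s (\<i> *s y) = y" for y :: "complex^'n"
        by (simp_all add: vec_eq_iff)
      then show ?thesis by (simp only: h_def gg vector_scalar_commute)
    qed
  qed (rule g)+
  then have gi: "g (\<i> *s x) = \<i> *s g x" for x
    unfolding fun_eq_iff h_def by (metis vector_smult_assoc vector_smult_lid i_squared minus_mult_minus
        mult_minus_left mult_minus_right minus_minus)
  have gc: "g (c *s x) = c *s g x" for c x
  proof -
    have dec: "c *s y = Re c *\<^sub>R y + Im c *\<^sub>R (\<i> *s y)" for y :: "complex^'n"
      by (simp add: vec_eq_iff complex_eq_iff)
    show ?thesis unfolding dec[of x] dec[of "g x"] by (simp add: g.add g.scaleR gi)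
  qed
  define S where "S = matrix g"
  have Sg: "S *v x = g x" for x
    unfolding S_def
    by (intro matrix_works) (unfold_locales, rule g.add, rule gc)
  have "herm_dot (g x) y = herm_dot x (g y)" for x y
  proof (rule complex_eqI)
    show "Re (herm_dot (g x) y) = Re (herm_dot x (g y))"
      using g(2)[of x y] by (simp add: inner_eq_Re_herm_dot)
    \<comment> \<open>Real self-adjointness sees only real parts; replacing \<open>y\<close> by
      \<open>\<i> *s y\<close> exposes the imaginary part.\<close>
    show "Im (herm_dot (g x) y) = Im (herm_dot x (g y))"
      using g(2)[of x "\<i> *s y"] by (simp add: inner_eq_Re_herm_dot gi herm_dot_scale_right)
  qed
  then have "herm_dot (S *v axis i 1) (axis j 1) = herm_dot (axis i 1) (S *v axis j 1)" for i j
    by (simp add: Sg)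
  then have "cnj (S $ j $ i) = S $ i $ j" for i j
    using cnj_herm_dot[of "S *v axis j 1" "axis i 1"]
    by (simp add: herm_dot_axis matrix_vector_mult_axis)
  then have "hermitian S" by (simp add: hermitian_def)
  moreover have "0 \<le> Re (herm_dot x (S *v x))" for x
    unfolding Sg using g(3)[of x] by (simp add: inner_eq_Re_herm_dot)
  ultimately have S: "herm_psd S" by (simp add: herm_psd_def)
  have "(S ** S) *v x = R *v x" for x
    by (simp add: Sg gg flip: matrix_vector_mul_assoc)
  then have SS: "S ** S = R" unfolding matrix_eq by blast
  have uniq: "T = S" if T: "herm_psd T" "T ** T = R" for T
  proof -
    have "(*v) T = (*v) S"
    proof (rule positive_sqrt_unique)
      show "T *v (T *v x) = S *v (S *v x)" for x
        by (simp only: matrix_vector_mul_assoc SS T(2))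
    qed (rule linear_complex_matrix herm_psd_operator[OF S] herm_psd_operator[OF T(1)])+
    then show ?thesis unfolding matrix_eq fun_eq_iff by blast
  qed
  have "herm_psd (psd_sqrt R) \<and> psd_sqrt R ** psd_sqrt R = R"
    unfolding psd_sqrt_def
  proof (rule theI[of "\<lambda>S. herm_psd S \<and> S ** S = R" S])
    show "herm_psd S \<and> S ** S = R" using S SS by (rule conjI)
    fix T assume "herm_psd T \<and> T ** T = R"
    then show "T = S" by (elim conjE) (rule uniq)
  qed
  then show "herm_psd (psd_sqrt R)" "psd_sqrt R ** psd_sqrt R = R" by blast+
qed

section \<open>The hypergeometric term\<close>

text \<open>The square of the generalised binomial coefficient of 1/2 over \<open>k\<close>, which
  is the \<open>k\<close>-th coefficient of 2F1(-1/2, -1/2; 1; x).\<close>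

definition hyp_coeff :: "nat \<Rightarrow> real" where
  "hyp_coeff k = (pochhammer (- 1 / 2) k / fact k)\<^sup>2"

lemma hyp_coeff_nonneg: "0 \<le> hyp_coeff k"
  by (simp add: hyp_coeff_def)

lemma hyp_coeff_0: "hyp_coeff 0 = 1"
  and hyp_coeff_1: "hyp_coeff (Suc 0) = 1 / 4"
  by (simp_all add: hyp_coeff_def power2_eq_square)

lemma hyp_coeff_Suc: "hyp_coeff (Suc k) = ((real k - 1 / 2) / (real k + 1))\<^sup>2 * hyp_coeff k"
  by (simp add: hyp_coeff_def pochhammer_Suc power_mult_distrib power_divide ac_simps)

text \<open>The unsquared coefficients are bounded by 1/(k+1) through their ratio recursion, so the
  squares are dominated by inverse squares. Summability at the end point \<open>x = 1\<close> is
  what covers fully correlated entries.\<close>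

lemma summable_hyp_coeff: "summable hyp_coeff"
proof (rule summable_comparison_test')
  show "summable (\<lambda>k. inverse (real (Suc k) ^ 2))"
    using inverse_power_summable[of 2] by (subst summable_Suc_iff) auto
  have *: "\<bar>pochhammer (- 1 / 2) k / fact k\<bar> \<le> 1 / (real k + 1)" for k :: nat
  proof (induction k)
    case (Suc k)
    have "\<bar>pochhammer (- 1 / 2) (Suc k) / fact (Suc k)\<bar> =
        \<bar>real k - 1 / 2\<bar> / (real k + 1) * \<bar>pochhammer (- 1 / 2) k / fact k :: real\<bar>"
    proof -
      have "pochhammer (- 1 / 2) (Suc k) / fact (Suc k) =
          (real k - 1 / 2) / (real k + 1) * (pochhammer (- 1 / 2) k / fact k :: real)"
        by (simp add: pochhammer_Suc field_simps)
      then show ?thesis by (simp only: abs_mult abs_divide)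
    qed
    also have "\<dots> \<le> \<bar>real k - 1 / 2\<bar> / (real k + 1) * (1 / (real k + 1))"
      by (rule mult_left_mono[OF Suc]) simp
    also have "\<dots> \<le> 1 / (real (Suc k) + 1)"
    proof (cases "k = 0")
      case False
      then have "(real k - 1 / 2) * (real k + 2) \<le> (real k + 1) * (real k + 1)"
        by (simp add: algebra_simps)
      with False show ?thesis by (simp add: divide_le_eq le_divide_eq ac_simps)
    qed simp
    finally show ?case .
  qed simp
  show "norm (hyp_coeff k) \<le> inverse (real (Suc k) ^ 2)" if "k \<ge> 0" for k
    using power_mono[OF *[of k], of 2] by (simp add: hyp_coeff_def power_divide inverse_eq_divide add.commute)
qed

lemma summable_hyp_series:
  assumes "0 \<le> x" "x \<le> 1"
  shows "summable (\<lambda>k. hyp_coeff k * x ^ k)"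
  by (rule summable_comparison_test'[OF summable_hyp_coeff, of 0])
    (use assms in \<open>auto simp: hyp_coeff_nonneg abs_mult power_le_one intro!: mult_left_le\<close>)

text \<open>The coefficients themselves are the majorants on the whole closed interval, so uniform
  convergence reaches 1.\<close>

lemma continuous_on_hyp_series: "continuous_on {0..1} (\<lambda>x. \<Sum>k. hyp_coeff k * x ^ k)"
proof (rule uniform_limit_theorem)
  show "uniform_limit {0..1} (\<lambda>n x. \<Sum>k<n. hyp_coeff k * x ^ k) (\<lambda>x. \<Sum>k. hyp_coeff k * x ^ k) sequentially"
    by (rule Weierstrass_m_test[OF _ summable_hyp_coeff])
      (auto simp: hyp_coeff_nonneg abs_mult power_le_one intro!: mult_left_le)
qed (auto intro!: always_eventually continuous_intros)

lemma hyp2f1_coeff: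
  "fps_nth (fps_hypergeo [3 / 2, 3 / 2] [1] 1) k = (pochhammer (3 / 2) k / fact k :: real)\<^sup>2"
  by (simp add: power2_eq_square flip: pochhammer_fact)

lemma fps_conv_radius_hyp2f1: "fps_conv_radius (fps_hypergeo [3 / 2, 3 / 2] [1] 1 :: real fps) = 1"
  unfolding fps_conv_radius_def
proof (rule conv_radius_ratio_limit_nonzero)
  have "norm (fps_nth (fps_hypergeo [3 / 2, 3 / 2] [1] 1) n :: real) / norm (fps_nth (fps_hypergeo [3 / 2, 3 / 2] [1] 1) (Suc n) :: real)
      = ((real n + 1) / (real n + 3 / 2))\<^sup>2" for n
  proof -
    define q :: real where "q = pochhammer (3 / 2) n / fact n"
    have "q > 0" by (simp add: q_def pochhammer_pos)
    moreover have "pochhammer (3 / 2) (Suc n) / fact (Suc n) = q * ((real n + 3 / 2) / (real n + 1))"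
      by (simp add: q_def pochhammer_Suc field_simps)
    ultimately show ?thesis
      unfolding hyp2f1_coeff by (simp only: q_def[symmetric]) (simp add: power_divide power_mult_distrib)
  qed
  then show "(\<lambda>n. norm (fps_nth (fps_hypergeo [3 / 2, 3 / 2] [1] 1) n :: real) /
      norm (fps_nth (fps_hypergeo [3 / 2, 3 / 2] [1] 1) (Suc n) :: real)) \<longlonglongrightarrow> 1"
    by (simp only:) real_asymp
qed auto

text \<open>Euler's transformation \<open>(1 - x)\<^sup>2 \<^sub>2F\<^sub>1(3/2, 3/2; 1; x) = \<^sub>2F\<^sub>1(-1/2, -1/2; 1; x)\<close>.\<close>

lemma euler_transform_hyp_coeff:
  "(1 - fps_X)\<^sup>2 * fps_hypergeo [3 / 2, 3 / 2] [1] 1 = Abs_fps hyp_coeff"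
proof -
  \<comment> \<open>Both Pochhammer symbols are rational multiples of this one: (3/2)_k / k! is
    (2k+1) c_k and (-1/2)_k / k! is -c_k / (2k-1).\<close>
  define c :: "nat \<Rightarrow> real" where "c k = pochhammer (1 / 2) k / fact k" for k
  have poch: "pochhammer (3 / 2) k / fact k = (2 * real k + 1) * c k" for k
    using pochhammer_rec[of "1 / 2 :: real" k] pochhammer_rec'[of "1 / 2 :: real" k]
    by (simp add: c_def field_simps)
  have poch': "(2 * real k - 1) * (pochhammer (- 1 / 2) k / fact k) = - c k" for k
  proof -
    have "(2 * real k - 1) * pochhammer (- 1 / 2) k = - pochhammer (1 / 2) k"
      using pochhammer_rec[of "- 1 / 2 :: real" k] pochhammer_rec'[of "- 1 / 2 :: real" k]
      by (simp add: algebra_simps)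
    then show ?thesis by (simp add: c_def)
  qed
  have cS: "c (Suc k) = (2 * real k + 1) / (2 * real k + 2) * c k" for k
    by (simp add: c_def pochhammer_Suc field_simps)
  have odd: "2 * real k - 1 \<noteq> 0" for k
  proof
    assume "2 * real k - 1 = 0"
    then have "real (2 * k) = real 1" by simp
    then have "2 * k = 1" by (simp only: of_nat_eq_iff)
    then show False by presburger
  qed
  have B: "hyp_coeff k = (c k / (2 * real k - 1))\<^sup>2" for k
    using poch'[of k] odd[of k] unfolding hyp_coeff_def by (metis nonzero_mult_div_cancel_left power2_minus minus_divide_left)
  define H :: "real fps" where "H = fps_hypergeo [3 / 2, 3 / 2] [1] 1"
  have H: "fps_nth H k = ((2 * real k + 1) * c k)\<^sup>2" for k
    by (simp add: H_def hyp2f1_coeff poch del: fps_hypergeo_nth)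
  have expand: "(1 - fps_X)\<^sup>2 * H = H - fps_const 2 * (fps_X * H) + fps_X * (fps_X * H)"
    by (simp add: power2_eq_square algebra_simps numeral_fps_const)
  have "fps_nth ((1 - fps_X)\<^sup>2 * H) k = hyp_coeff k" for k
  proof -
    \<comment> \<open>Multiplication by (1 - X)^2 involves three consecutive coefficients, so the
      first two indices are checked by hand.\<close>
    consider "k = 0" | "k = 1" | m where "k = Suc (Suc m)"
      by (metis One_nat_def not0_implies_Suc)
    then show ?thesis
    proof cases
      case (3 m)
      define r :: real where "r = real m"
      have r: "2 * r + 1 \<noteq> 0" "2 * r + 3 \<noteq> 0" "r + 1 \<noteq> 0" "r + 2 \<noteq> 0" by (simp_all add: r_def)
      \<comment> \<open>A common factor that clears denominators: \<open>c m\<close>,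
        \<open>c (Suc m)\<close> and \<open>c (Suc (Suc m))\<close> all become polynomials in
        \<open>r\<close> times \<open>t\<close>, and the claim becomes a polynomial
        identity.\<close>
      define t where "t = c m / (4 * (r + 1) * (r + 2))"
      have c0: "c m = 4 * (r + 1) * (r + 2) * t"
        using r by (simp add: t_def)
      have "(r + 1) * (2 * c (Suc m)) = (2 * r + 1) * c m"
        using r(3) by (simp add: cS divide_simps flip: r_def)
      also have "\<dots> = (r + 1) * (2 * (2 * (2 * r + 1) * (r + 2) * t))"
        unfolding c0 by algebra
      finally have c1: "c (Suc m) = 2 * (2 * r + 1) * (r + 2) * t"
        using r(3) unfolding mult_cancel_left by simp
      have "(r + 2) * (2 * c (Suc (Suc m))) = (2 * r + 3) * c (Suc m)"
        using r(4) by (simp add: cS[of "Suc m"] divide_simps flip: r_def) (simp add: algebra_simps)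
      also have "\<dots> = (r + 2) * (2 * ((2 * r + 3) * (2 * r + 1) * t))"
        unfolding c1 by algebra
      finally have c2: "c (Suc (Suc m)) = (2 * r + 3) * (2 * r + 1) * t"
        using r(4) unfolding mult_cancel_left by simp
      note c = c0 c1 c2
      have "c (Suc (Suc m)) / (2 * real k - 1) = (2 * r + 1) * t"
        using r(2) unfolding c(3) 3 by (simp add: r_def field_simps)
      then show ?thesis
        unfolding B expand unfolding 3 by (simp add: H c flip: r_def) (simp add: power2_eq_square algebra_simps)
    qed (simp_all only: expand, simp_all add: H hyp_coeff_0 hyp_coeff_1 c_def power2_eq_square)
  qed
  then show ?thesis by (simp add: fps_eq_iff flip: H_def)
qed

lemma hyp2f1_eq_series:
  assumes "0 \<le> x" "x < 1"
  shows "(1 - x)\<^sup>2 * hyp2f1 (3 / 2) (3 / 2) 1 x = (\<Sum>k. hyp_coeff k * x ^ k)"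
proof -
  have "norm x < fps_conv_radius ((1 - fps_X)\<^sup>2 :: real fps)"
    by (rule less_le_trans[OF _ fps_conv_radius_power]) (auto intro: less_le_trans[OF _ fps_conv_radius_diff])
  then have "eval_fps (Abs_fps hyp_coeff) x =
      eval_fps ((1 - fps_X)\<^sup>2) x * eval_fps (fps_hypergeo [3 / 2, 3 / 2] [1] 1) x"
    unfolding euler_transform_hyp_coeff[symmetric] using assms
    by (intro eval_fps_mult) (simp_all add: fps_conv_radius_hyp2f1)
  also have "eval_fps ((1 - fps_X)\<^sup>2) x = (1 - x)\<^sup>2"
    by (subst eval_fps_power) (auto simp: eval_fps_diff intro: less_le_trans[OF _ fps_conv_radius_diff])
  finally show ?thesis by (simp add: hyp2f1_def eval_fps_def)
qed

text \<open>At 1 the left limit of the original expression is that of the transformed series, by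
  equality just below 1, and continuity up to 1 evaluates it.\<close>

lemma hyp_term_eq_series:
  assumes "0 \<le> x" "x \<le> 1"
  shows "hyp_term x = (\<Sum>k. hyp_coeff k * x ^ k)"
proof (cases "x = 1")
  case True
  have "((\<lambda>y. \<Sum>k. hyp_coeff k * y ^ k) \<longlongrightarrow> (\<Sum>k. hyp_coeff k * 1 ^ k)) (at 1 within {0..1})"
    using continuous_on_hyp_series unfolding continuous_on_def by (rule bspec) simp
  then have "((\<lambda>y. \<Sum>k. hyp_coeff k * y ^ k) \<longlongrightarrow> (\<Sum>k. hyp_coeff k * 1 ^ k)) (at_left 1)"
    by (simp add: at_within_Icc_at_left)
  moreover have "\<forall>\<^sub>F y in at_left 1. (\<Sum>k. hyp_coeff k * y ^ k) = (1 - y)\<^sup>2 * hyp2f1 (3 / 2) (3 / 2) 1 y"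
    by (rule eventually_mono[OF eventually_at_left_real[of 0 "1 :: real"]]) (auto simp: hyp2f1_eq_series)
  ultimately have "((\<lambda>y. (1 - y)\<^sup>2 * hyp2f1 (3 / 2) (3 / 2) 1 y) \<longlongrightarrow> (\<Sum>k. hyp_coeff k * 1 ^ k)) (at_left 1)"
    by (rule Lim_transform_eventually)
  then show ?thesis by (simp add: hyp_term_def True tendsto_Lim)
qed (use assms hyp2f1_eq_series[of x] in \<open>auto simp: hyp_term_def\<close>)

section \<open>An integral representation of the modulus\<close>

lemma nn_integral_gaussian_halfline:
  assumes "b > 0"
  shows "(\<integral>\<^sup>+r. ennreal (exp (- (r\<^sup>2 * b\<^sup>2))) * indicator {0..} r \<partial>lborel) = ennreal (sqrt pi / (2 * b))"
proof -
  have "has_bochner_integral lborel (\<lambda>r. indicator {0..} (0 + b * r) *\<^sub>R exp (- (0 + b * r)\<^sup>2))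
      ((sqrt pi / 2) /\<^sub>R \<bar>b\<bar>)"
    using gaussian_moment_0 assms by (subst lborel_has_bochner_integral_real_affine_iff[symmetric]) auto
  moreover have "indicator {0..} (0 + b * r) *\<^sub>R exp (- (0 + b * r)\<^sup>2) =
      exp (- (r\<^sup>2 * b\<^sup>2)) * (indicator {0..} r :: real)" for r
    using assms by (auto simp: indicator_def power_mult_distrib mult.commute zero_le_mult_iff)
  ultimately have *: "has_bochner_integral lborel (\<lambda>r. exp (- (r\<^sup>2 * b\<^sup>2)) * (indicator {0..} r :: real))
      (sqrt pi / (2 * b))"
    using assms by (simp add: field_simps)
  have "(\<integral>\<^sup>+r. ennreal (exp (- (r\<^sup>2 * b\<^sup>2)) * indicator {0..} r) \<partial>lborel) = ennreal (sqrt pi / (2 * b))"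
    using * by (subst nn_integral_eq_integral) (auto simp: has_bochner_integral_iff)
  then show ?thesis by (simp add: ennreal_mult' ennreal_indicator)
qed

text \<open>At \<open>r = 0\<close> division by zero gives the value 0 instead of the limit a^2;
  integrals over \<open>r\<close> discard this point as a null set.\<close>

definition laplace_kernel :: "real \<Rightarrow> real \<Rightarrow> real" where
  "laplace_kernel a r = (1 - exp (- (r\<^sup>2 * a\<^sup>2))) / r\<^sup>2"

lemma laplace_kernel_nonneg: "0 \<le> laplace_kernel a r"
  by (simp add: laplace_kernel_def)

lemma borel_measurable_laplace_kernel[measurable]:
  "case_prod laplace_kernel \<in> borel_measurable (borel \<Otimes>\<^sub>M borel)"
  unfolding laplace_kernel_def[abs_def] case_prod_beta by measurable

text \<open>Obtained from \<open>(1 - exp (-r\<^sup>2a\<^sup>2)) / r\<^sup>2 = \<integral>\<^sub>0\<^sup>a 2b exp (-r\<^sup>2b\<^sup>2) db\<close> by exchanging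
  the two integrations.\<close>

lemma nn_integral_laplace_kernel:
  assumes a: "0 \<le> a"
  shows "(\<integral>\<^sup>+r. ennreal (laplace_kernel a r) * indicator {0..} r \<partial>lborel) = ennreal (sqrt pi * a)"
proof -
  define f where "f r b = ennreal (2 * b * exp (- (r\<^sup>2 * b\<^sup>2))) * indicator {0..a} b * indicator {0..} r"
    for r b :: real
  have [measurable]: "case_prod f \<in> borel_measurable (borel \<Otimes>\<^sub>M borel)"
    unfolding f_def[abs_def] case_prod_beta by measurable
  have "(\<integral>\<^sup>+r. ennreal (laplace_kernel a r) * indicator {0..} r \<partial>lborel) =
      (\<integral>\<^sup>+r. \<integral>\<^sup>+b. f r b \<partial>lborel \<partial>lborel)"
  proof (rule nn_integral_cong_AE, rule eventually_mono[OF AE_lborel_singleton[of 0]])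
    fix r :: real assume r: "r \<noteq> 0"
    have "(\<integral>\<^sup>+b. ennreal (2 * b * exp (- (r\<^sup>2 * b\<^sup>2))) * indicator {0..a} b \<partial>lborel) =
        ennreal (- exp (- (r\<^sup>2 * a\<^sup>2)) / r\<^sup>2 - - exp (- (r\<^sup>2 * 0\<^sup>2)) / r\<^sup>2)"
      using a r by (intro nn_integral_FTC_Icc)
        (auto intro!: derivative_eq_intros simp: power2_eq_square field_simps)
    also have "\<dots> = ennreal (laplace_kernel a r)"
      by (simp add: laplace_kernel_def diff_divide_distrib)
    finally show "ennreal (laplace_kernel a r) * indicator {0..} r = (\<integral>\<^sup>+b. f r b \<partial>lborel)"
      by (simp add: f_def nn_integral_multc)
  qed
  also have "\<dots> = (\<integral>\<^sup>+b. \<integral>\<^sup>+r. f r b \<partial>lborel \<partial>lborel)"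
    by (rule lborel_pair.Fubini'[symmetric]) measurable
  also have "\<dots> = (\<integral>\<^sup>+b. ennreal (sqrt pi) * indicator {0..a} b \<partial>lborel)"
  proof (rule nn_integral_cong_AE, rule eventually_mono[OF AE_lborel_singleton[of 0]])
    \<comment> \<open>The point \<open>b = 0\<close> must be left out: there the integrand vanishes,
      while the right side is \<open>sqrt pi\<close>.\<close>
    fix b :: real assume b: "b \<noteq> 0"
    show "(\<integral>\<^sup>+r. f r b \<partial>lborel) = ennreal (sqrt pi) * indicator {0..a} b"
    proof (cases "b \<in> {0..a}")
      case True
      with b have b: "b > 0" by auto
      have "(\<integral>\<^sup>+r. f r b \<partial>lborel) =
          (\<integral>\<^sup>+r. ennreal (2 * b) * (ennreal (exp (- (r\<^sup>2 * b\<^sup>2))) * indicator {0..} r) \<partial>lborel)"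
        using True b by (intro nn_integral_cong) (simp add: f_def ennreal_mult' ac_simps)
      also have "\<dots> = ennreal (2 * b) * ennreal (sqrt pi / (2 * b))"
        using nn_integral_gaussian_halfline[OF b] by (subst nn_integral_cmult) simp_all
      also have "\<dots> = ennreal (sqrt pi)"
        using b by (simp flip: ennreal_mult')
      finally show ?thesis using True by simp
    qed (simp add: f_def)
  qed
  also have "\<dots> = ennreal (sqrt pi * a)"
    using a by (simp add: nn_integral_cmult_indicator ennreal_mult')
  finally show ?thesis .
qed

section \<open>Termwise integration of the expanded Laplace transform\<close>

text \<open>One-variable factors of the coefficient of x^k in the expected product of two kernels.
  The geometric series alone gives r^(2k-2) / (1+r^2)^(k+1); at \<open>k = 0\<close> the three
  remaining terms of the product combine with it into 1/(1+r^2), hence the separate clause and the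
  shifted exponents in the other.\<close>

fun lap_coeff :: "nat \<Rightarrow> real \<Rightarrow> real" where
  "lap_coeff 0 r = 1 / (1 + r\<^sup>2)"
| "lap_coeff (Suc k) r = r ^ (2 * k) / (1 + r\<^sup>2) ^ (k + 2)"

lemma lap_coeff_nonneg: "0 \<le> lap_coeff k r"
  by (cases k) (simp_all add: zero_le_even_power)

lemma borel_measurable_lap_coeff[measurable]: "lap_coeff k \<in> borel_measurable borel"
  by (cases k) (simp_all add: lap_coeff.simps[abs_def])

lemma one_plus_square_pos: "0 < 1 + (r::real)\<^sup>2"
  by (simp add: add_pos_nonneg)

text \<open>The derivative of r^(2k+1) / (1+r^2)^(k+2) is (2k+1) times coefficient k+1 minus (2k+4)
  times coefficient k+2. This function vanishes at 0 and at infinity, so consecutive integrals have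
  ratio (2k+1)/(2k+4), which is also the ratio of the roots of \<open>hyp_coeff\<close>. The
  recursion starts at index 1, so 0 and 1 are both base cases. The square root appears because the
  integral occurs once for each of two variables.\<close>

lemma lap_coeff_antiderivative:
  "\<exists>F. (\<forall>r. (F has_real_derivative lap_coeff k r) (at r)) \<and> F 0 = 0 \<and>
     (F \<longlongrightarrow> pi / 2 * sqrt (hyp_coeff k)) at_top"
proof (induction k rule: induct_nat_012)
  case 0
  show ?case
    by (intro exI[of _ arctan])
      (auto simp: hyp_coeff_0 inverse_eq_divide intro!: derivative_eq_intros tendsto_arctan_at_top)
next
  case 1
  define F :: "real \<Rightarrow> real" where "F r = (r / (1 + r\<^sup>2) + arctan r) / 2" for r
  have "(F has_real_derivative lap_coeff (Suc 0) r) (at r)" for r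
  proof -
    have nz: "1 + r\<^sup>2 \<noteq> 0" using one_plus_square_pos[of r] by simp
    have "(F has_real_derivative ((1 * (1 + r\<^sup>2) - r * (2 * r)) / (1 + r\<^sup>2)\<^sup>2 + 1 / (1 + r\<^sup>2)) / 2) (at r)"
      unfolding F_def using nz
      by (auto intro!: derivative_eq_intros simp: power2_eq_square inverse_eq_divide)
    also have "((1 * (1 + r\<^sup>2) - r * (2 * r)) / (1 + r\<^sup>2)\<^sup>2 + 1 / (1 + r\<^sup>2)) / 2 = lap_coeff (Suc 0) r"
      using nz by (simp add: divide_simps) (simp add: power2_eq_square algebra_simps)
    finally show ?thesis .
  qed
  moreover have "(F \<longlongrightarrow> (0 + pi / 2) / 2) at_top"
    unfolding F_def
    by (intro tendsto_divide tendsto_add tendsto_arctan_at_top tendsto_const) (real_asymp | simp)+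
  ultimately show ?case
    by (intro exI[of _ F] conjI allI) (simp_all add: F_def[of 0] hyp_coeff_1 real_sqrt_divide)
next
  case (ge2 k)
  then obtain F where F: "\<And>r. (F has_real_derivative lap_coeff (Suc k) r) (at r)" "F 0 = 0"
    "(F \<longlongrightarrow> pi / 2 * sqrt (hyp_coeff (Suc k))) at_top" by auto
  define G :: "real \<Rightarrow> real" where "G r = r ^ (2 * k + 1) / (1 + r\<^sup>2) ^ (k + 2)" for r
  define H where "H r = (real (2 * k + 1) * F r - G r) / real (2 * k + 4)" for r
  have G: "(G has_real_derivative
      real (2 * k + 1) * lap_coeff (Suc k) r - real (2 * k + 4) * lap_coeff (Suc (Suc k)) r) (at r)" for r
  proof -
    define p where "p = 1 + r\<^sup>2"
    have nz: "p \<noteq> 0" using one_plus_square_pos[of r] by (simp add: p_def)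
    have "(G has_real_derivative
        (real (2 * k + 1) * r ^ (2 * k) * p ^ (k + 2) - r ^ (2 * k + 1) * (real (k + 2) * p ^ (k + 1) * (2 * r)))
          / (p ^ (k + 2) * p ^ (k + 2))) (at r)"
      unfolding G_def p_def using nz[unfolded p_def]
      by (auto intro!: derivative_eq_intros simp del: power_Suc)
    also have "(real (2 * k + 1) * r ^ (2 * k) * p ^ (k + 2) - r ^ (2 * k + 1) * (real (k + 2) * p ^ (k + 1) * (2 * r)))
          / (p ^ (k + 2) * p ^ (k + 2)) =
        real (2 * k + 1) * lap_coeff (Suc k) r - real (2 * k + 4) * lap_coeff (Suc (Suc k)) r"
    proof -
      have "(m * Q * (P * p\<^sup>2) - Q * r * (n * (P * p) * (2 * r))) / ((P * p\<^sup>2) * (P * p\<^sup>2)) =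
          m * (Q / (P * p\<^sup>2)) - 2 * n * (Q * r\<^sup>2 / (P * p ^ 3))" if "P \<noteq> 0" for P Q m n :: real
        using nz that by (simp add: field_simps power2_eq_square power3_eq_cube)
      from this[of "p ^ k" "real (2 * k + 1)" "r ^ (2 * k)" "real (k + 2)"] nz show ?thesis
        by (simp add: power_add power2_eq_square power3_eq_cube ac_simps
            flip: p_def p_def[unfolded power2_eq_square])
    qed
    finally show ?thesis .
  qed
  have "(H has_real_derivative lap_coeff (Suc (Suc k)) r) (at r)" for r
  proof -
    have "(H has_real_derivative (real (2 * k + 1) * lap_coeff (Suc k) r -
        (real (2 * k + 1) * lap_coeff (Suc k) r - real (2 * k + 4) * lap_coeff (Suc (Suc k)) r)) /
        real (2 * k + 4)) (at r)"
      unfolding H_def by (intro DERIV_cdivide DERIV_diff DERIV_cmult F G)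
    then show ?thesis by (simp only: diff_diff_eq2 add_diff_cancel_left') simp
  qed
  moreover have "(G \<longlongrightarrow> 0) at_top"
  proof (rule tendsto_sandwich)
    show "\<forall>\<^sub>F r in at_top. 0 \<le> G r"
      using eventually_gt_at_top[of 0] by eventually_elim (simp add: G_def)
    show "\<forall>\<^sub>F r in at_top. G r \<le> 1 / r"
      using eventually_gt_at_top[of 0]
    proof eventually_elim
      case (elim r)
      have "r ^ (2 * k + 1) * r = (r\<^sup>2) ^ (k + 1)"
        by (simp add: power_mult power2_eq_square power_mult_distrib ac_simps)
      also have "\<dots> \<le> (1 + r\<^sup>2) ^ (k + 1)" by (intro power_mono) auto
      also have "\<dots> \<le> (1 + r\<^sup>2) ^ (k + 2)" by (intro power_increasing) auto
      finally have "r ^ (2 * k + 1) \<le> (1 + r\<^sup>2) ^ (k + 2) / r"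
        using elim by (simp only: pos_le_divide_eq)
      then show ?case
        unfolding G_def by (intro mult_imp_div_pos_le zero_less_power one_plus_square_pos) simp
    qed
    show "((\<lambda>r::real. 1 / r) \<longlongrightarrow> 0) at_top" by real_asymp
  qed simp
  then have "(H \<longlongrightarrow> (real (2 * k + 1) * (pi / 2 * sqrt (hyp_coeff (Suc k))) - 0) / real (2 * k + 4)) at_top"
    unfolding H_def by (intro tendsto_intros F(3)) auto
  moreover have "(real (2 * k + 1) * (pi / 2 * sqrt (hyp_coeff (Suc k))) - 0) / real (2 * k + 4) =
      pi / 2 * sqrt (hyp_coeff (Suc (Suc k)))"
  proof -
    have "sqrt (hyp_coeff (Suc (Suc k))) = real (2 * k + 1) / real (2 * k + 4) * sqrt (hyp_coeff (Suc k))"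
    proof -
      have "\<bar>(real (Suc k) - 1 / 2) / (real (Suc k) + 1)\<bar> = real (2 * k + 1) / real (2 * k + 4)"
        by (subst abs_of_nonneg) (auto simp: field_simps)
      then show ?thesis
        unfolding hyp_coeff_Suc[of "Suc k"] real_sqrt_mult real_sqrt_abs by simp
    qed
    then show ?thesis by simp
  qed
  moreover have "H 0 = 0"
    by (simp add: H_def F G_def)
  ultimately show ?case
    by (intro exI[of _ H] conjI allI) (simp_all only:)
qed

lemma nn_integral_lap_coeff:
  "(\<integral>\<^sup>+r. ennreal (lap_coeff k r) * indicator {0..} r \<partial>lborel) = ennreal (pi / 2 * sqrt (hyp_coeff k))"
proof -
  obtain F where F: "\<And>r. (F has_real_derivative lap_coeff k r) (at r)" "F 0 = 0"
    "(F \<longlongrightarrow> pi / 2 * sqrt (hyp_coeff k)) at_top"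
    using lap_coeff_antiderivative[of k] by auto
  show ?thesis
    using nn_integral_FTC_atLeast[OF borel_measurable_lap_coeff F(1) lap_coeff_nonneg F(3), of 0] F(2) by simp
qed

text \<open>The ratio of the geometric series is \<open>x * r\<^sup>2 * t\<^sup>2 / ((1 + r\<^sup>2)
  * (1 + t\<^sup>2))\<close>, which stays below 1 even for \<open>x = 1\<close>.\<close>

lemma lap_coeff_sums:
  fixes r t x :: real
  assumes "r \<noteq> 0" "t \<noteq> 0" "0 \<le> x" "x \<le> 1"
  shows "(\<lambda>k. x ^ k * (lap_coeff k r * lap_coeff k t)) sums
    ((1 - 1 / (1 + r\<^sup>2) - 1 / (1 + t\<^sup>2) + 1 / ((1 + r\<^sup>2) * (1 + t\<^sup>2) - r\<^sup>2 * t\<^sup>2 * x)) / (r\<^sup>2 * t\<^sup>2))"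
proof -
  define a b where "a = r\<^sup>2" and "b = t\<^sup>2"
  have ab: "a > 0" "b > 0" using assms by (auto simp: a_def b_def)
  define y where "y = x * (a * b) / ((1 + a) * (1 + b))"
  have ab1: "a * b < (1 + a) * (1 + b)" using ab by (simp add: algebra_simps)
  have "x * (a * b) \<le> a * b" using ab assms by (simp add: mult_left_le_one_le)
  with ab1 have less: "x * (a * b) < (1 + a) * (1 + b)" by simp
  then have y: "0 \<le> y" "y < 1"
    using ab assms by (auto simp: y_def divide_less_eq)
  have "(\<lambda>k. x / ((1 + a) * (1 + b))\<^sup>2 * y ^ k) sums (x / ((1 + a) * (1 + b))\<^sup>2 * (1 / (1 - y)))"
    using y by (intro sums_mult geometric_sums) simp
  moreover have "x / ((1 + a) * (1 + b))\<^sup>2 * y ^ k = x ^ Suc k * (lap_coeff (Suc k) r * lap_coeff (Suc k) t)" for k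
    using ab by (simp add: y_def power_divide power_mult_distrib power_mult power_add power2_eq_square[of "1 + _"] flip: a_def b_def)
      (simp add: ac_simps)
  ultimately have "(\<lambda>k. x ^ Suc k * (lap_coeff (Suc k) r * lap_coeff (Suc k) t)) sums
      (x / ((1 + a) * (1 + b))\<^sup>2 * (1 / (1 - y)))"
    by (simp only:)
  then have "(\<lambda>k. x ^ k * (lap_coeff k r * lap_coeff k t)) sums
      (x / ((1 + a) * (1 + b))\<^sup>2 * (1 / (1 - y)) + x ^ 0 * (lap_coeff 0 r * lap_coeff 0 t))"
    by (subst (asm) sums_Suc_iff) simp
  also have "x / ((1 + a) * (1 + b))\<^sup>2 * (1 / (1 - y)) + x ^ 0 * (lap_coeff 0 r * lap_coeff 0 t) =
      (1 - 1 / (1 + a) - 1 / (1 + b) + 1 / ((1 + a) * (1 + b) - a * b * x)) / (a * b)"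
  proof -
    define d where "d = (1 + a) * (1 + b)"
    define e where "e = d - a * b * x"
    have nz: "a \<noteq> 0" "b \<noteq> 0" "1 + a \<noteq> 0" "1 + b \<noteq> 0" "d \<noteq> 0" "e \<noteq> 0"
      using ab less by (auto simp: d_def e_def ac_simps)
    have "1 - y = e / d" using nz by (simp add: y_def e_def field_simps flip: d_def)
    then have "x / d\<^sup>2 * (1 / (1 - y)) = x / (d * e)"
      using nz by (simp add: power2_eq_square)
    moreover have "x / (d * e) + 1 / d = (1 - 1 / (1 + a) - 1 / (1 + b) + 1 / e) / (a * b)"
    proof -
      have 1: "1 - 1 / (1 + a) - 1 / (1 + b) = a * b / d - 1 / d"
        using nz unfolding d_def by (simp add: divide_simps) (simp add: algebra_simps)
      have 2: "1 / e - 1 / d = a * b * x / (d * e)"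
        using nz by (simp add: divide_simps e_def)
      have "(1 - 1 / (1 + a) - 1 / (1 + b) + 1 / e) / (a * b) = (a * b / d + a * b * x / (d * e)) / (a * b)"
        unfolding 1 2[symmetric] by simp
      also have "\<dots> = x / (d * e) + 1 / d"
        using nz by (simp add: add_divide_distrib)
      finally show ?thesis ..
    qed
    moreover have "x ^ 0 * (lap_coeff 0 r * lap_coeff 0 t) = 1 / d"
      by (simp add: d_def flip: a_def b_def)
    ultimately show ?thesis by (simp only: flip: d_def e_def)
  qed
  finally show ?thesis by (simp add: a_def b_def)
qed

text \<open>All terms are nonnegative, so sum and integrals commute. Each term is a product of two
  equal one-variable integrals, whose square roots multiply to \<open>hyp_coeff k\<close>.\<close>

lemma nn_integral_lap_series:
  assumes x: "0 \<le> x" "x \<le> 1"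
  shows "(\<integral>\<^sup>+r. \<integral>\<^sup>+t. ennreal ((1 - 1 / (1 + r\<^sup>2) - 1 / (1 + t\<^sup>2) +
      1 / ((1 + r\<^sup>2) * (1 + t\<^sup>2) - r\<^sup>2 * t\<^sup>2 * x)) / (r\<^sup>2 * t\<^sup>2)) * indicator {0..} t * indicator {0..} r
      \<partial>lborel \<partial>lborel) = ennreal (pi\<^sup>2 / 4 * hyp_term x)"
    (is "?lhs = _")
proof -
  define f where "f k r = ennreal (lap_coeff k r) * indicator {0..} r" for k r
  have [measurable]: "f k \<in> borel_measurable borel" for k
    unfolding f_def[abs_def] by measurable
  have "?lhs = (\<integral>\<^sup>+r. \<integral>\<^sup>+t. (\<Sum>k. ennreal (x ^ k) * (f k r * f k t)) \<partial>lborel \<partial>lborel)"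
  proof (intro nn_integral_cong_AE, rule eventually_mono[OF AE_lborel_singleton[of 0]],
      intro nn_integral_cong_AE, rule eventually_mono[OF AE_lborel_singleton[of 0]])
    \<comment> \<open>Off the axes only: on them the closed form is a division by zero, whereas the
      series need not vanish.\<close>
    fix r t :: real assume nz: "r \<noteq> 0" "t \<noteq> 0"
    note S = lap_coeff_sums[OF nz x]
    have "ennreal ((1 - 1 / (1 + r\<^sup>2) - 1 / (1 + t\<^sup>2) +
      1 / ((1 + r\<^sup>2) * (1 + t\<^sup>2) - r\<^sup>2 * t\<^sup>2 * x)) / (r\<^sup>2 * t\<^sup>2)) = (\<Sum>k. ennreal (x ^ k * (lap_coeff k r * lap_coeff k t)))"
      unfolding sums_unique[OF S]
      by (rule suminf_ennreal2[symmetric]) (use x S lap_coeff_nonneg in \<open>auto simp: sums_iff\<close>)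
    then show "ennreal ((1 - 1 / (1 + r\<^sup>2) - 1 / (1 + t\<^sup>2) +
      1 / ((1 + r\<^sup>2) * (1 + t\<^sup>2) - r\<^sup>2 * t\<^sup>2 * x)) / (r\<^sup>2 * t\<^sup>2)) * indicator {0..} t * indicator {0..} r =
      (\<Sum>k. ennreal (x ^ k) * (f k r * f k t))"
      using x lap_coeff_nonneg by (auto simp: f_def indicator_def ennreal_mult)
  qed
  also have "\<dots> = (\<Sum>k. \<integral>\<^sup>+r. \<integral>\<^sup>+t. ennreal (x ^ k) * (f k r * f k t) \<partial>lborel \<partial>lborel)"
    by (simp add: nn_integral_suminf)
  also have "\<dots> = (\<Sum>k. ennreal (pi\<^sup>2 / 4 * (hyp_coeff k * x ^ k)))"
  proof (rule suminf_cong)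
    fix k
    have "(\<integral>\<^sup>+r. \<integral>\<^sup>+t. ennreal (x ^ k) * (f k r * f k t) \<partial>lborel \<partial>lborel) =
        ennreal (x ^ k) * ((\<integral>\<^sup>+r. f k r \<partial>lborel) * (\<integral>\<^sup>+t. f k t \<partial>lborel))"
      by (simp add: nn_integral_cmult nn_integral_multc)
    also have "\<dots> = ennreal (x ^ k * ((pi / 2 * sqrt (hyp_coeff k)) * (pi / 2 * sqrt (hyp_coeff k))))"
      unfolding f_def nn_integral_lap_coeff using x hyp_coeff_nonneg
      by (subst ennreal_mult, simp, simp, subst ennreal_mult) simp_all
    also have "x ^ k * ((pi / 2 * sqrt (hyp_coeff k)) * (pi / 2 * sqrt (hyp_coeff k))) =
        pi\<^sup>2 / 4 * (hyp_coeff k * x ^ k)"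
      using hyp_coeff_nonneg[of k] by (simp add: power2_eq_square)
    finally show "(\<integral>\<^sup>+r. \<integral>\<^sup>+t. ennreal (x ^ k) * (f k r * f k t) \<partial>lborel \<partial>lborel) =
        ennreal (pi\<^sup>2 / 4 * (hyp_coeff k * x ^ k))" .
  qed
  also have "\<dots> = ennreal (\<Sum>k. pi\<^sup>2 / 4 * (hyp_coeff k * x ^ k))"
    using x hyp_coeff_nonneg by (intro suminf_ennreal2 summable_mult summable_hyp_series) auto
  also have "(\<Sum>k. pi\<^sup>2 / 4 * (hyp_coeff k * x ^ k)) = pi\<^sup>2 / 4 * hyp_term x"
    using x by (subst suminf_mult) (simp_all add: hyp_term_eq_series summable_hyp_series)
  finally show ?thesis .
qed

section \<open>Complex Gaussian vectors\<close>

lemma inner_complex_eq_Re: "z \<bullet> w = Re (cnj z * w)" for z w :: complex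
  by (simp add: inner_complex_def)

lemma inner_scale_left: "(z *s c) \<bullet> x = z \<bullet> herm_dot c x"
  by (simp add: inner_eq_Re_herm_dot herm_dot_scale_left inner_complex_eq_Re)

lemma norm_scale: "norm (z *s c) = cmod z * norm c" for c :: "complex ^ 'n"
proof -
  have "complex_of_real ((norm (z *s c))\<^sup>2) = complex_of_real ((cmod z * norm c)\<^sup>2)"
    unfolding herm_dot_self[symmetric] herm_dot_scale_left herm_dot_scale_right
    by (simp add: herm_dot_self power_mult_distrib)
      (metis complex_norm_square mult.commute of_real_power)
  then have "(norm (z *s c))\<^sup>2 = (cmod z * norm c)\<^sup>2" by (simp only: of_real_eq_iff)
  then show ?thesis by (simp add: power2_eq_iff_nonneg)
qed

text \<open>Scaling \<open>c\<close> by the number \<open>herm_dot c d\<close> makes the real inner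
  product equal to its squared modulus, so the real Cauchy-Schwarz inequality yields the complex
  one.\<close>

lemma cmod_herm_dot_le: "cmod (herm_dot c d) \<le> norm c * norm d"
proof (cases "herm_dot c d = 0")
  case False
  have "(cmod (herm_dot c d))\<^sup>2 = (herm_dot c d *s c) \<bullet> d"
    by (simp add: inner_scale_left dot_square_norm)
  also have "\<dots> \<le> cmod (herm_dot c d) * norm c * norm d"
    using norm_cauchy_schwarz[of "herm_dot c d *s c" d] by (simp add: norm_scale)
  finally show ?thesis using False by (simp add: power2_eq_square)
qed simp

lemma norm_axis: "norm (axis k z) = norm z" for z :: complex
  by (simp add: norm_eq_sqrt_inner inner_axis)

lemma inner_axis_left: "axis k z \<bullet> x = z \<bullet> (x $ k)" for x :: "complex ^ 'n"
  by (simp add: inner_commute inner_axis)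

lemma (in prob_space) nn_integral_gaussian_exp_quadratic:
  assumes X: "distributed M lborel X (normal_density 0 (sqrt (1 / 2)))" and s: "s > - 1"
  shows "(\<integral>\<^sup>+\<omega>. ennreal (exp (2 * b * X \<omega> - s * (X \<omega>)\<^sup>2)) \<partial>M) = ennreal (exp (b\<^sup>2 / (1 + s)) / sqrt (1 + s))"
proof -
  \<comment> \<open>Completing the square in -x^2 + 2bx - sx^2 gives a normal density with mean
    b/(1+s) and variance 1/(2(1+s)).\<close>
  define \<sigma> where "\<sigma> = sqrt (1 / (2 * (1 + s)))"
  have \<sigma>: "\<sigma> > 0" "\<sigma>\<^sup>2 = 1 / (2 * (1 + s))" using s by (simp_all add: \<sigma>_def)
  have eq: "normal_density 0 (sqrt (1 / 2)) x * exp (2 * b * x - s * x\<^sup>2) =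
      exp (b\<^sup>2 / (1 + s)) / sqrt (1 + s) * normal_density (b / (1 + s)) \<sigma> x" for x
  proof -
    have "- (x\<^sup>2) + (2 * b * x - s * x\<^sup>2) = b\<^sup>2 / (1 + s) - (x - b / (1 + s))\<^sup>2 * (1 + s)"
    proof -
      define y where "y = b / (1 + s)"
      have "b = y * (1 + s)" using s by (simp add: y_def)
      moreover from this have "b\<^sup>2 / (1 + s) = y\<^sup>2 * (1 + s)" using s by (simp add: power2_eq_square)
      ultimately show ?thesis
        unfolding y_def[symmetric] by (simp add: power2_eq_square algebra_simps)
    qed
    then have "exp (- (x\<^sup>2)) * exp (2 * b * x - s * x\<^sup>2) =
        exp (b\<^sup>2 / (1 + s)) * exp (- ((x - b / (1 + s))\<^sup>2 * (1 + s)))"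
      by (simp flip: exp_add)
    moreover have "sqrt (2 * pi * \<sigma>\<^sup>2) = sqrt pi / sqrt (1 + s)"
    proof -
      have "2 * pi * \<sigma>\<^sup>2 = pi / (1 + s)" using s unfolding \<sigma>(2) by (simp add: field_simps)
      then show ?thesis by (simp add: real_sqrt_divide)
    qed
    moreover have "(x - b / (1 + s))\<^sup>2 / (2 * \<sigma>\<^sup>2) = (x - b / (1 + s))\<^sup>2 * (1 + s)"
      unfolding \<sigma>(2) using s by simp
    moreover have "sqrt (1 + s) > 0" using s by simp
    ultimately show ?thesis
      unfolding normal_density_def by (simp add: field_simps)
  qed
  have "(\<integral>\<^sup>+\<omega>. ennreal (exp (2 * b * X \<omega> - s * (X \<omega>)\<^sup>2)) \<partial>M) =
      (\<integral>\<^sup>+x. ennreal (normal_density 0 (sqrt (1 / 2)) x) * ennreal (exp (2 * b * x - s * x\<^sup>2)) \<partial>lborel)"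
    by (rule distributed_nn_integral[OF X, symmetric]) simp
  also have "\<dots> = (\<integral>\<^sup>+x. ennreal (exp (b\<^sup>2 / (1 + s)) / sqrt (1 + s)) * ennreal (normal_density (b / (1 + s)) \<sigma> x) \<partial>lborel)"
    using s by (intro nn_integral_cong) (simp add: eq flip: ennreal_mult')
  also have "\<dots> = ennreal (exp (b\<^sup>2 / (1 + s)) / sqrt (1 + s)) * (\<integral>\<^sup>+x. ennreal (normal_density (b / (1 + s)) \<sigma> x) \<partial>lborel)"
    by (rule nn_integral_cmult) simp
  also have "(\<integral>\<^sup>+x. ennreal (normal_density (b / (1 + s)) \<sigma> x) \<partial>lborel) = 1"
    using \<sigma>(1) by (subst nn_integral_eq_integral) auto
  finally show ?thesis by simp
qed

text \<open>The second integration variable over the same space \<open>M\<close> acts as an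
  independent copy, so no further random vector has to be constructed.\<close>

lemma (in prob_space) integral_swap_bounded:
  fixes f :: "'a \<Rightarrow> 'a \<Rightarrow> complex"
  assumes [measurable]: "case_prod f \<in> borel_measurable (M \<Otimes>\<^sub>M M)" and "\<And>x y. cmod (f x y) \<le> B"
  shows "(\<integral>y. \<integral>x. f x y \<partial>M \<partial>M) = (\<integral>x. \<integral>y. f x y \<partial>M \<partial>M)"
proof -
  interpret pair_prob_space M M ..
  show ?thesis
    by (rule Fubini_integral, rule P.integrable_const_bound[where B = B]) (use assms in auto)
qed

section \<open>Distributions and Laplace transforms of linear forms of a Gaussian vector\<close>

locale complex_gaussian_vector = prob_space M for M :: "'a measure" +
  fixes u :: "'a \<Rightarrow> complex ^ 'n"
  assumes std: "std_complex_gaussian M u"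
begin

definition coord :: "'n \<times> bool \<Rightarrow> 'a \<Rightarrow> real" where
  "coord = (\<lambda>(i, b) \<omega>. if b then Im (u \<omega> $ i) else Re (u \<omega> $ i))"

lemma indep_coord: "indep_vars (\<lambda>_. borel) coord UNIV"
  using std by (simp add: std_complex_gaussian_def coord_def)

lemma distributed_coord: "distributed M lborel (coord p) (normal_density 0 (sqrt (1 / 2)))"
  using std by (cases p; cases "snd p") (auto simp: std_complex_gaussian_def coord_def)

lemma borel_measurable_component[measurable]: "(\<lambda>\<omega>. u \<omega> $ i) \<in> borel_measurable M"
proof -
  have [measurable]: "coord p \<in> borel_measurable M" for p
    using distributed_measurable[OF distributed_coord[of p]] by simp
  have "(\<lambda>\<omega>. u \<omega> $ i) = (\<lambda>\<omega>. Complex (coord (i, False) \<omega>) (coord (i, True) \<omega>))"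
    by (simp add: coord_def)
  also have "\<dots> = (\<lambda>\<omega>. complex_of_real (coord (i, False) \<omega>) + \<i> * complex_of_real (coord (i, True) \<omega>))"
    by (simp add: complex_eq_iff fun_eq_iff)
  finally show ?thesis by simp
qed

lemma borel_measurable_herm_dot[measurable]: "(\<lambda>\<omega>. herm_dot c (u \<omega>)) \<in> borel_measurable M"
  unfolding herm_dot_def by measurable

lemma borel_measurable_inner_vector[measurable]: "(\<lambda>\<omega>. c \<bullet> u \<omega>) \<in> borel_measurable M"
  unfolding inner_eq_Re_herm_dot by measurable

lemma distributed_inner:
  assumes "c \<noteq> 0"
  shows "distributed M lborel (\<lambda>\<omega>. c \<bullet> u \<omega>) (normal_density 0 (norm c / sqrt 2))"
proof -
  define a :: "'n \<times> bool \<Rightarrow> real" where "a = (\<lambda>(i, b). if b then Im (c $ i) else Re (c $ i))"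
  \<comment> \<open>Zero coefficients are dropped because the law of a sum of independent normals
    requires positive standard deviations.\<close>
  define I where "I = {p. a p \<noteq> 0}"
  have sum_all: "(\<Sum>p\<in>I. f p) = (\<Sum>i\<in>UNIV. f (i, False) + f (i, True))"
    if "\<And>p. p \<notin> I \<Longrightarrow> f p = 0" for f :: "'n \<times> bool \<Rightarrow> real"
  proof -
    have "(\<Sum>p\<in>I. f p) = (\<Sum>p\<in>UNIV \<times> UNIV. f p)"
      using that by (intro sum.mono_neutral_left) auto
    also have "\<dots> = (\<Sum>i\<in>UNIV. \<Sum>b\<in>UNIV. f (i, b))"
      by (simp add: sum.cartesian_product)
    finally show ?thesis by (simp add: UNIV_bool)
  qed
  have nc: "(\<Sum>p\<in>I. (a p)\<^sup>2) = (norm c)\<^sup>2"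
    by (subst sum_all) (auto simp: I_def a_def norm_vec_def L2_set_def cmod_power2 sum_nonneg)
  have norm: "sqrt (\<Sum>p\<in>I. (\<bar>a p\<bar> * sqrt (1 / 2))\<^sup>2) = norm c / sqrt 2"
    by (simp add: power_divide real_sqrt_divide nc flip: sum_divide_distrib)
  have "I \<noteq> {}"
  proof
    assume "I = {}"
    with nc assms show False by simp
  qed
  moreover have "indep_vars (\<lambda>_. borel) (\<lambda>p \<omega>. a p * coord p \<omega>) I"
    by (rule indep_vars_compose2[OF indep_vars_subset[OF indep_coord]]) auto
  moreover have "distributed M lborel (\<lambda>\<omega>. a p * coord p \<omega>) (normal_density 0 (\<bar>a p\<bar> * sqrt (1 / 2)))"
    if "p \<in> I" for p
    using normal_density_affine[OF distributed_coord[of p], of "a p" 0] that by (simp add: I_def)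
  ultimately have "distributed M lborel (\<lambda>\<omega>. \<Sum>p\<in>I. a p * coord p \<omega>)
      (normal_density (\<Sum>p\<in>I. 0) (sqrt (\<Sum>p\<in>I. (\<bar>a p\<bar> * sqrt (1 / 2))\<^sup>2)))"
    by (intro sum_indep_normal) (auto simp: I_def)
  moreover have "(\<Sum>p\<in>I. a p * coord p \<omega>) = c \<bullet> u \<omega>" for \<omega>
    by (subst sum_all) (auto simp: I_def a_def coord_def inner_vec_def inner_complex_def)
  ultimately show ?thesis by (simp add: norm)
qed

text \<open>The real linear form has variance |c|^2 / 2, whence the 4 in the exponent. All Laplace
  transforms below are reduced to this formula.\<close>

lemma expectation_iexp_inner:
  "expectation (\<lambda>\<omega>. iexp (c \<bullet> u \<omega>)) = complex_of_real (exp (- (norm c)\<^sup>2 / 4))"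
proof (cases "c = 0")
  case False
  define \<sigma> where "\<sigma> = norm c / sqrt 2"
  have \<sigma>: "\<sigma> > 0" "\<sigma>\<^sup>2 = (norm c)\<^sup>2 / 2" using False by (simp_all add: \<sigma>_def power_divide)
  have D: "distributed M lborel (\<lambda>\<omega>. (c \<bullet> u \<omega> - 0) / \<sigma>) std_normal_density"
    using distributed_inner[OF False, folded \<sigma>_def]
    unfolding normal_standard_normal_convert[OF \<sigma>(1)] .
  have "expectation (\<lambda>\<omega>. iexp (c \<bullet> u \<omega>)) = expectation (\<lambda>\<omega>. iexp (\<sigma> * ((c \<bullet> u \<omega> - 0) / \<sigma>)))"
    using \<sigma>(1) by simp
  also have "\<dots> = (\<integral>x. iexp (\<sigma> * x) \<partial>distr M lborel (\<lambda>\<omega>. (c \<bullet> u \<omega> - 0) / \<sigma>))"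
    by (rule integral_distr[symmetric]) (simp_all add: distributed_measurable[OF D])
  also have "\<dots> = char std_normal_distribution \<sigma>"
    by (simp add: char_def distributed_distr_eq_density[OF D, simplified])
  finally show ?thesis by (simp add: char_std_normal_distribution \<sigma>(2))
qed (simp add: prob_space)

lemma expectation_inner_square: "expectation (\<lambda>\<omega>. (c \<bullet> u \<omega>)\<^sup>2) = (norm c)\<^sup>2 / 2"
  and integrable_inner_square: "integrable M (\<lambda>\<omega>. (c \<bullet> u \<omega>)\<^sup>2)"
proof -
  have "expectation (\<lambda>\<omega>. (c \<bullet> u \<omega>)\<^sup>2) = (norm c)\<^sup>2 / 2 \<and> integrable M (\<lambda>\<omega>. (c \<bullet> u \<omega>)\<^sup>2)"
  proof (cases "c = 0")
    case False
    define \<sigma> where "\<sigma> = norm c / sqrt 2"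
    have \<sigma>: "\<sigma> > 0" "\<sigma>\<^sup>2 = (norm c)\<^sup>2 / 2" using False by (simp_all add: \<sigma>_def power_divide)
    note D = distributed_inner[OF False, folded \<sigma>_def]
    have "integrable M (\<lambda>\<omega>. (c \<bullet> u \<omega>)\<^sup>2)"
      using integrable_normal_moment[OF \<sigma>(1), of 0 2] distributed_integrable[OF D, of "\<lambda>x. x\<^sup>2"] by simp
    then show ?thesis
      using normal_distributed_variance[OF \<sigma>(1) D] normal_distributed_expectation[OF \<sigma>(1) D] \<sigma>(2) by simp
  qed simp
  then show "expectation (\<lambda>\<omega>. (c \<bullet> u \<omega>)\<^sup>2) = (norm c)\<^sup>2 / 2" "integrable M (\<lambda>\<omega>. (c \<bullet> u \<omega>)\<^sup>2)"
    by auto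
qed

lemma cmod_herm_dot_square: "(cmod (herm_dot c x))\<^sup>2 = (c \<bullet> x)\<^sup>2 + ((\<i> *s c) \<bullet> x)\<^sup>2"
  by (simp add: inner_eq_Re_herm_dot herm_dot_scale_left cmod_power2)

lemma expectation_cmod_square: "expectation (\<lambda>\<omega>. (cmod (herm_dot c (u \<omega>)))\<^sup>2) = (norm c)\<^sup>2"
  and integrable_cmod_square: "integrable M (\<lambda>\<omega>. (cmod (herm_dot c (u \<omega>)))\<^sup>2)"
  by (simp_all add: cmod_herm_dot_square expectation_inner_square integrable_inner_square norm_scale)

lemma AE_herm_dot_nonzero:
  assumes "c \<noteq> 0"
  shows "AE \<omega> in M. herm_dot c (u \<omega>) \<noteq> 0"
proof -
  note D = distributed_inner[OF assms]
  have "AE x in distr M lborel (\<lambda>\<omega>. c \<bullet> u \<omega>). x \<noteq> 0"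
    unfolding distributed_distr_eq_density[OF D]
    by (subst AE_density) (auto intro: eventually_mono[OF AE_lborel_singleton[of 0]])
  then have "AE \<omega> in M. c \<bullet> u \<omega> \<noteq> 0"
    by (subst (asm) AE_distr_iff) (simp_all add: distributed_measurable[OF D])
  then show ?thesis by eventually_elim (auto simp: inner_eq_Re_herm_dot)
qed

lemma nn_integral_component_exp_quadratic:
  assumes s: "s > - 1"
  shows "(\<integral>\<^sup>+\<omega>. ennreal (exp (2 * (b \<bullet> (u \<omega> $ k)) - s * (cmod (u \<omega> $ k))\<^sup>2)) \<partial>M) =
     ennreal (exp ((cmod b)\<^sup>2 / (1 + s)) / (1 + s))"
proof -
  define B where "B p = (if snd p then Im b else Re b)" for p :: "'n \<times> bool"
  define X where "X p \<omega> = ennreal (exp (2 * B p * coord p \<omega> - s * (coord p \<omega>)\<^sup>2))" for p \<omega>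
  define I where "I = {(k, False), (k, True)}"
  have "indep_vars (\<lambda>_. borel) X I"
    unfolding X_def[abs_def]
    by (rule indep_vars_compose2[OF indep_vars_subset[OF indep_coord]]) auto
  then have "(\<integral>\<^sup>+\<omega>. (\<Prod>p\<in>I. X p \<omega>) \<partial>M) = (\<Prod>p\<in>I. \<integral>\<^sup>+\<omega>. X p \<omega> \<partial>M)"
    by (intro indep_vars_nn_integral) (auto simp: I_def)
  also have "\<dots> = (\<Prod>p\<in>I. ennreal (exp ((B p)\<^sup>2 / (1 + s)) / sqrt (1 + s)))"
    unfolding X_def by (intro prod.cong nn_integral_gaussian_exp_quadratic s distributed_coord refl)
  also have "\<dots> = ennreal (exp ((cmod b)\<^sup>2 / (1 + s)) / (1 + s))"
    using s by (simp add: I_def B_def cmod_power2 add_divide_distrib exp_add flip: ennreal_mult')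
  also have "(\<lambda>\<omega>. \<Prod>p\<in>I. X p \<omega>) =
      (\<lambda>\<omega>. ennreal (exp (2 * (b \<bullet> (u \<omega> $ k)) - s * (cmod (u \<omega> $ k))\<^sup>2)))"
    by (auto simp: I_def X_def B_def coord_def inner_complex_def cmod_power2 algebra_simps
        simp flip: ennreal_mult' exp_add)
  finally show ?thesis .
qed

lemma expectation_component_exp_quadratic:
  assumes s: "s > - 1"
  shows "expectation (\<lambda>\<omega>. exp (2 * (b \<bullet> (u \<omega> $ k)) - s * (cmod (u \<omega> $ k))\<^sup>2)) =
    exp ((cmod b)\<^sup>2 / (1 + s)) / (1 + s)"
  using s by (subst integral_eq_nn_integral) (auto simp: nn_integral_component_exp_quadratic)

text \<open>An independent copy of one coordinate linearises the square in the exponent: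
  \<open>exp (-s |z|\<^sup>2)\<close> is the characteristic function of a complex Gaussian.\<close>

lemma exp_square_eq_expectation:
  assumes "0 \<le> s"
  shows "complex_of_real (exp (- (s * (cmod z)\<^sup>2))) = expectation (\<lambda>\<omega>. iexp (2 * sqrt s * (z \<bullet> (u \<omega> $ k))))"
proof -
  have "axis k ((2 * sqrt s) *\<^sub>R z) \<bullet> u \<omega> = 2 * sqrt s * (z \<bullet> (u \<omega> $ k))" for \<omega>
    by (simp add: inner_axis_left)
  moreover have "- (norm (axis k ((2 * sqrt s) *\<^sub>R z) :: complex ^ 'n))\<^sup>2 / 4 = - (s * (cmod z)\<^sup>2)"
    using assms by (simp add: norm_axis power_mult_distrib)
  ultimately show ?thesis
    using expectation_iexp_inner[of "axis k ((2 * sqrt s) *\<^sub>R z)"] by simp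
qed

text \<open>Gathers the term created by linearising a square and an existing linear term into one
  linear form in \<open>x\<close>, ready for the characteristic function.\<close>

lemma inner_herm_dot_shift:
  "2 * r * (herm_dot c x \<bullet> z) + b \<bullet> x = (complex_of_real (2 * r) *s (z *s c) + b) \<bullet> x"
  by (simp add: inner_add_left inner_scale_left herm_dot_scale_left inner_complex_def algebra_simps)

text \<open>After linearising the square and swapping integrals, the vector is integrated out by its
  characteristic function, leaving a Gaussian integral in one entry of the copy. The factor
  \<open>iexp (b \<bullet> u \<omega>)\<close> is carried along so that a second square, once
  linearised, can be absorbed into \<open>b\<close>.\<close>

lemma expectation_laplace_iexp:
  assumes s: "0 \<le> s"
  shows "expectation (\<lambda>\<omega>. complex_of_real (exp (- (s * (cmod (herm_dot c (u \<omega>)))\<^sup>2))) * iexp (b \<bullet> u \<omega>)) =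
    complex_of_real (exp (s * (cmod (herm_dot c b))\<^sup>2 / (4 * (1 + s * (norm c)\<^sup>2)) - (norm b)\<^sup>2 / 4)
      / (1 + s * (norm c)\<^sup>2))"
    (is "?lhs = _")
proof -
  \<comment> \<open>Any coordinate will do; the copy needs a single complex Gaussian entry.\<close>
  define k :: 'n where "k = undefined"
  define g where "g \<omega> = u \<omega> $ k" for \<omega>
  have [measurable]: "g \<in> borel_measurable M" unfolding g_def by measurable
  define v where "v \<omega> = complex_of_real (2 * sqrt s) *s (g \<omega> *s c) + b" for \<omega>
  have "?lhs = (\<integral>\<omega>. (\<integral>\<omega>'. iexp (2 * sqrt s * (herm_dot c (u \<omega>) \<bullet> g \<omega>')) * iexp (b \<bullet> u \<omega>) \<partial>M) \<partial>M)"
    unfolding exp_square_eq_expectation[OF s, of _ k] g_def by simp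
  also have "\<dots> = (\<integral>\<omega>. (\<integral>\<omega>'. iexp (2 * sqrt s * (herm_dot c (u \<omega>) \<bullet> g \<omega>') + b \<bullet> u \<omega>) \<partial>M) \<partial>M)"
    by (simp add: distrib_left exp_add)
  also have "\<dots> = (\<integral>\<omega>'. (\<integral>\<omega>. iexp (2 * sqrt s * (herm_dot c (u \<omega>) \<bullet> g \<omega>') + b \<bullet> u \<omega>) \<partial>M) \<partial>M)"
    by (rule integral_swap_bounded[where B = 1, symmetric]) (simp_all add: case_prod_beta)
  also have "\<dots> = (\<integral>\<omega>'. complex_of_real (exp (- (norm (v \<omega>'))\<^sup>2 / 4)) \<partial>M)"
    unfolding inner_herm_dot_shift v_def[symmetric] expectation_iexp_inner ..
  also have "\<dots> = complex_of_real (\<integral>\<omega>'. exp (- (norm (v \<omega>'))\<^sup>2 / 4) \<partial>M)"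
    by (rule integral_complex_of_real)
  also have "(\<lambda>\<omega>'. exp (- (norm (v \<omega>'))\<^sup>2 / 4)) =
      (\<lambda>\<omega>'. exp (- (norm b)\<^sup>2 / 4) *
        exp (2 * ((- (sqrt s / 2) *\<^sub>R herm_dot c b) \<bullet> (u \<omega>' $ k)) - s * (norm c)\<^sup>2 * (cmod (u \<omega>' $ k))\<^sup>2))"
  proof
    fix \<omega>'
    have "(norm (x + b))\<^sup>2 = (norm x)\<^sup>2 + 2 * (x \<bullet> b) + (norm b)\<^sup>2" for x :: "complex ^ 'n"
      by (simp add: power2_norm_eq_inner inner_add_left inner_add_right inner_commute)
    then have "(norm (v \<omega>'))\<^sup>2 = (2 * sqrt s * cmod (g \<omega>') * norm c)\<^sup>2 + 4 * sqrt s * (g \<omega>' \<bullet> herm_dot c b) + (norm b)\<^sup>2"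
      using s unfolding v_def
      by (simp add: inner_scale_left norm_scale norm_mult herm_dot_scale_left mult.assoc flip: scaleR_conv_of_real)
        (simp add: inner_complex_def algebra_simps)
    also have "(2 * sqrt s * cmod (g \<omega>') * norm c)\<^sup>2 = 4 * s * (cmod (g \<omega>'))\<^sup>2 * (norm c)\<^sup>2"
      using s by (simp add: power_mult_distrib)
    finally have "- (norm (v \<omega>'))\<^sup>2 / 4 = - (norm b)\<^sup>2 / 4 +
        (2 * ((- (sqrt s / 2) *\<^sub>R herm_dot c b) \<bullet> (u \<omega>' $ k)) - s * (norm c)\<^sup>2 * (cmod (u \<omega>' $ k))\<^sup>2)"
      by (simp add: g_def inner_commute)
    then show "exp (- (norm (v \<omega>'))\<^sup>2 / 4) = exp (- (norm b)\<^sup>2 / 4) *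
        exp (2 * ((- (sqrt s / 2) *\<^sub>R herm_dot c b) \<bullet> (u \<omega>' $ k)) - s * (norm c)\<^sup>2 * (cmod (u \<omega>' $ k))\<^sup>2)"
      by (simp only: exp_add)
  qed
  also have "(\<integral>\<omega>'. exp (- (norm b)\<^sup>2 / 4) *
        exp (2 * ((- (sqrt s / 2) *\<^sub>R herm_dot c b) \<bullet> (u \<omega>' $ k)) - s * (norm c)\<^sup>2 * (cmod (u \<omega>' $ k))\<^sup>2) \<partial>M) =
      exp (- (norm b)\<^sup>2 / 4) * (exp ((cmod (- (sqrt s / 2) *\<^sub>R herm_dot c b))\<^sup>2 / (1 + s * (norm c)\<^sup>2)) / (1 + s * (norm c)\<^sup>2))"
    using s by (subst integral_mult_right_zero, subst expectation_component_exp_quadratic) (auto intro: less_le_trans[of _ 0])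
  also have "\<dots> = exp (s * (cmod (herm_dot c b))\<^sup>2 / (4 * (1 + s * (norm c)\<^sup>2)) - (norm b)\<^sup>2 / 4)
      / (1 + s * (norm c)\<^sup>2)"
  proof -
    have sq: "(cmod (- (sqrt s / 2) *\<^sub>R herm_dot c b))\<^sup>2 = s * (cmod (herm_dot c b))\<^sup>2 / 4"
      using s by (simp add: power_mult_distrib power_divide)
    have "- (norm b)\<^sup>2 / 4 + (cmod (- (sqrt s / 2) *\<^sub>R herm_dot c b))\<^sup>2 / (1 + s * (norm c)\<^sup>2) =
        s * (cmod (herm_dot c b))\<^sup>2 / (4 * (1 + s * (norm c)\<^sup>2)) - (norm b)\<^sup>2 / 4"
      unfolding sq by simp
    then show ?thesis by (simp only: times_divide_eq_right exp_add[symmetric])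
  qed
  finally show ?thesis .
qed

text \<open>The second square is linearised and the previous lemma removes the first one, leaving
  exp (-q|g|^2) / p in one Gaussian entry g. The value 1 / (p(1+q)) is the reciprocal of a
  two-by-two determinant, and linear dependence of \<open>c\<close> and \<open>d\<close> is
  allowed.\<close>

lemma expectation_laplace_pair:
  assumes s: "0 \<le> s" and t: "0 \<le> t"
  shows "expectation (\<lambda>\<omega>. exp (- (s * (cmod (herm_dot c (u \<omega>)))\<^sup>2)) * exp (- (t * (cmod (herm_dot d (u \<omega>)))\<^sup>2))) =
    1 / ((1 + s * (norm c)\<^sup>2) * (1 + t * (norm d)\<^sup>2) - s * t * (cmod (herm_dot c d))\<^sup>2)"
    (is "?lhs = _")
proof -
  define k :: 'n where "k = undefined"
  define g where "g \<omega> = u \<omega> $ k" for \<omega>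
  have [measurable]: "g \<in> borel_measurable M" unfolding g_def by measurable
  define e where "e \<omega> = complex_of_real (exp (- (s * (cmod (herm_dot c (u \<omega>)))\<^sup>2)))" for \<omega>
  have [measurable]: "e \<in> borel_measurable M" unfolding e_def by measurable
  define p where "p = 1 + s * (norm c)\<^sup>2"
  have p: "p > 0" using s by (simp add: p_def add_pos_nonneg)
  define \<kappa> where "\<kappa> = (cmod (herm_dot c d))\<^sup>2"
  define q where "q = t * (norm d)\<^sup>2 - s * t * \<kappa> / p"
  \<comment> \<open>Cauchy-Schwarz makes \<open>q\<close> nonnegative, which secures the final
    Gaussian integral.\<close>
  have "s * \<kappa> \<le> s * ((norm c)\<^sup>2 * (norm d)\<^sup>2)"
    using s power_mono[OF cmod_herm_dot_le[of c d], of 2]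
    by (intro mult_left_mono) (auto simp: \<kappa>_def power_mult_distrib)
  also have "\<dots> \<le> (norm d)\<^sup>2 * p"
    by (simp add: p_def algebra_simps)
  finally have "t * (s * \<kappa> / p) \<le> t * (norm d)\<^sup>2"
    using p t by (intro mult_left_mono) (auto simp: divide_le_eq)
  then have q: "q \<ge> 0" by (simp add: q_def mult.left_commute mult.assoc)
  \<comment> \<open>The summand 0 matches \<open>inner_herm_dot_shift\<close> with no prior linear
    term.\<close>
  define v where "v \<omega> = complex_of_real (2 * sqrt t) *s (g \<omega> *s d) + 0" for \<omega>
  have "complex_of_real ?lhs =
      (\<integral>\<omega>. complex_of_real (exp (- (s * (cmod (herm_dot c (u \<omega>)))\<^sup>2)) * exp (- (t * (cmod (herm_dot d (u \<omega>)))\<^sup>2))) \<partial>M)"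
    by (rule integral_complex_of_real[symmetric])
  also have "\<dots> = (\<integral>\<omega>. e \<omega> * complex_of_real (exp (- (t * (cmod (herm_dot d (u \<omega>)))\<^sup>2))) \<partial>M)"
    by (simp add: e_def)
  also have "\<dots> = (\<integral>\<omega>. (\<integral>\<omega>'. e \<omega> * iexp (2 * sqrt t * (herm_dot d (u \<omega>) \<bullet> g \<omega>') + 0 \<bullet> u \<omega>) \<partial>M) \<partial>M)"
    unfolding exp_square_eq_expectation[OF t, of _ k] g_def by simp
  also have "\<dots> = (\<integral>\<omega>'. (\<integral>\<omega>. e \<omega> * iexp (2 * sqrt t * (herm_dot d (u \<omega>) \<bullet> g \<omega>') + 0 \<bullet> u \<omega>) \<partial>M) \<partial>M)"
    using s by (intro integral_swap_bounded[where B = 1, symmetric])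
      (simp_all add: case_prod_beta norm_mult e_def)
  also have "\<dots> = (\<integral>\<omega>'. complex_of_real (exp (s * (cmod (herm_dot c (v \<omega>')))\<^sup>2 / (4 * p) - (norm (v \<omega>'))\<^sup>2 / 4) / p) \<partial>M)"
    unfolding inner_herm_dot_shift v_def[symmetric] e_def expectation_laplace_iexp[OF s] p_def ..
  also have "\<dots> = complex_of_real (\<integral>\<omega>'. exp (s * (cmod (herm_dot c (v \<omega>')))\<^sup>2 / (4 * p) - (norm (v \<omega>'))\<^sup>2 / 4) / p \<partial>M)"
    by (rule integral_complex_of_real)
  also have "(\<lambda>\<omega>'. exp (s * (cmod (herm_dot c (v \<omega>')))\<^sup>2 / (4 * p) - (norm (v \<omega>'))\<^sup>2 / 4) / p) =
      (\<lambda>\<omega>'. exp (2 * (0 \<bullet> (u \<omega>' $ k)) - q * (cmod (u \<omega>' $ k))\<^sup>2) / p)"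
  proof
    fix \<omega>'
    have "(norm (v \<omega>'))\<^sup>2 = 4 * t * (cmod (g \<omega>'))\<^sup>2 * (norm d)\<^sup>2"
      "(cmod (herm_dot c (v \<omega>')))\<^sup>2 = 4 * t * (cmod (g \<omega>'))\<^sup>2 * \<kappa>"
      using t by (simp_all add: v_def norm_scale herm_dot_scale_right norm_mult power_mult_distrib \<kappa>_def)
    then have "s * (cmod (herm_dot c (v \<omega>')))\<^sup>2 / (4 * p) - (norm (v \<omega>'))\<^sup>2 / 4 = - (q * (cmod (g \<omega>'))\<^sup>2)"
      using p by (simp add: q_def divide_simps) (simp add: algebra_simps)
    then show "exp (s * (cmod (herm_dot c (v \<omega>')))\<^sup>2 / (4 * p) - (norm (v \<omega>'))\<^sup>2 / 4) / p =
        exp (2 * (0 \<bullet> (u \<omega>' $ k)) - q * (cmod (u \<omega>' $ k))\<^sup>2) / p"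
      by (simp add: g_def)
  qed
  also have "(\<integral>\<omega>'. exp (2 * (0 \<bullet> (u \<omega>' $ k)) - q * (cmod (u \<omega>' $ k))\<^sup>2) / p \<partial>M) = 1 / (1 + q) / p"
    using q by (subst integral_divide_zero, subst expectation_component_exp_quadratic) auto
  also have "\<dots> = 1 / (p * (1 + t * (norm d)\<^sup>2) - s * t * \<kappa>)"
  proof -
    have "p * (1 + q) = p * (1 + t * (norm d)\<^sup>2) - s * t * \<kappa>"
      using p by (simp add: q_def algebra_simps)
    then show ?thesis by (simp add: mult.commute)
  qed
  finally show ?thesis by (simp only: of_real_eq_iff p_def \<kappa>_def)
qed

lemma expectation_laplace:
  assumes s: "0 \<le> s"
  shows "expectation (\<lambda>\<omega>. exp (- (s * (cmod (herm_dot c (u \<omega>)))\<^sup>2))) = 1 / (1 + s * (norm c)\<^sup>2)"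
  using expectation_laplace_pair[OF s, of 0 c 0] by simp

end

section \<open>Expected moduli and products of moduli\<close>

lemma hyp_term_nonneg:
  assumes "0 \<le> x" "x \<le> 1"
  shows "0 \<le> hyp_term x"
  using assms by (simp add: hyp_term_eq_series hyp_coeff_nonneg suminf_nonneg summable_hyp_series)

context complex_gaussian_vector
begin

lemma nn_integral_laplace_kernel_swap:
  assumes [measurable]: "f \<in> borel_measurable M" and "\<And>\<omega>. 0 \<le> f \<omega>"
  shows "(\<integral>\<^sup>+\<omega>. ennreal (sqrt pi * f \<omega>) \<partial>M) =
    (\<integral>\<^sup>+r. (\<integral>\<^sup>+\<omega>. ennreal (laplace_kernel (f \<omega>) r) \<partial>M) * indicator {0..} r \<partial>lborel)"
proof -
  interpret pair_sigma_finite M lborel ..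
  have "(\<integral>\<^sup>+\<omega>. ennreal (sqrt pi * f \<omega>) \<partial>M) =
      (\<integral>\<^sup>+\<omega>. \<integral>\<^sup>+r. ennreal (laplace_kernel (f \<omega>) r) * indicator {0..} r \<partial>lborel \<partial>M)"
    by (simp add: nn_integral_laplace_kernel assms)
  also have "\<dots> = (\<integral>\<^sup>+r. \<integral>\<^sup>+\<omega>. ennreal (laplace_kernel (f \<omega>) r) * indicator {0..} r \<partial>M \<partial>lborel)"
    by (rule Fubini'[symmetric]) measurable
  finally show ?thesis by (simp add: nn_integral_multc)
qed

text \<open>The expected kernel is 1/(1+r^2), with integral pi/2; dividing by the
  \<open>sqrt pi\<close> of the integral representation gives \<open>sqrt pi / 2\<close>.\<close>

lemma has_bochner_integral_cmod_unit:
  assumes c: "norm c = 1"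
  shows "has_bochner_integral M (\<lambda>\<omega>. cmod (herm_dot c (u \<omega>))) (sqrt pi / 2)"
proof (rule has_bochner_integral_nn_integral)
  let ?f = "\<lambda>\<omega>. cmod (herm_dot c (u \<omega>))"
  have "ennreal (sqrt pi) * (\<integral>\<^sup>+\<omega>. ennreal (?f \<omega>) \<partial>M) = (\<integral>\<^sup>+\<omega>. ennreal (sqrt pi * ?f \<omega>) \<partial>M)"
    by (simp add: nn_integral_cmult ennreal_mult')
  also have "\<dots> = (\<integral>\<^sup>+r. (\<integral>\<^sup>+\<omega>. ennreal (laplace_kernel (?f \<omega>) r) \<partial>M) * indicator {0..} r \<partial>lborel)"
    by (rule nn_integral_laplace_kernel_swap) auto
  also have "\<dots> = (\<integral>\<^sup>+r. ennreal (lap_coeff 0 r) * indicator {0..} r \<partial>lborel)"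
  proof (rule nn_integral_cong_AE, rule eventually_mono[OF AE_lborel_singleton[of 0]])
    fix r :: real assume r: "r \<noteq> 0"
    have int: "integrable M (\<lambda>\<omega>. exp (- (r\<^sup>2 * (?f \<omega>)\<^sup>2)))"
      by (rule integrable_const_bound[where B = 1]) auto
    have "(\<integral>\<^sup>+\<omega>. ennreal (laplace_kernel (?f \<omega>) r) \<partial>M) = ennreal (expectation (\<lambda>\<omega>. laplace_kernel (?f \<omega>) r))"
      unfolding laplace_kernel_def using int
      by (intro nn_integral_eq_integral) (auto simp: prob_space)
    also have "expectation (\<lambda>\<omega>. laplace_kernel (?f \<omega>) r) = (1 - 1 / (1 + r\<^sup>2)) / r\<^sup>2"
      unfolding laplace_kernel_def using int expectation_laplace[of "r\<^sup>2" c]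
      by (simp add: c prob_space)
    also have "\<dots> = lap_coeff 0 r"
    proof -
      have "1 - 1 / (1 + r\<^sup>2) = r\<^sup>2 / (1 + r\<^sup>2)"
        using one_plus_square_pos[of r] by (simp add: field_simps)
      then show ?thesis using r by simp
    qed
    finally show "(\<integral>\<^sup>+\<omega>. ennreal (laplace_kernel (?f \<omega>) r) \<partial>M) * indicator {0..} r =
        ennreal (lap_coeff 0 r) * indicator {0..} r" by simp
  qed
  also have "\<dots> = ennreal (sqrt pi) * ennreal (sqrt pi / 2)"
    unfolding nn_integral_lap_coeff by (simp add: hyp_coeff_0 flip: ennreal_mult')
  finally show "(\<integral>\<^sup>+\<omega>. ennreal (?f \<omega>) \<partial>M) = ennreal (sqrt pi / 2)"
    by (subst (asm) ennreal_mult_cancel_left) auto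
qed auto

lemma has_bochner_integral_cmod:
  "has_bochner_integral M (\<lambda>\<omega>. cmod (herm_dot c (u \<omega>))) (norm c * sqrt pi / 2)"
proof (cases "c = 0")
  case False
  have "cmod (herm_dot c x) = norm c * cmod (herm_dot (c /\<^sub>R norm c) x)" for x
    using False by (simp add: herm_dot_scaleR_left)
  moreover have "has_bochner_integral M (\<lambda>\<omega>. norm c * cmod (herm_dot (c /\<^sub>R norm c) (u \<omega>))) (norm c * (sqrt pi / 2))"
    using False by (intro has_bochner_integral_mult_right has_bochner_integral_cmod_unit) auto
  ultimately show ?thesis by simp
qed (simp add: herm_dot_def has_bochner_integral_zero)

text \<open>Each modulus is replaced by its own kernel integral, and the expectation is moved
  innermost. The two factors \<open>sqrt pi\<close> give pi on the left, so pi^2/4 from the double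
  integral becomes pi/4.\<close>

lemma has_bochner_integral_cmod_pair:
  assumes c: "norm c = 1" and d: "norm d = 1"
  shows "has_bochner_integral M (\<lambda>\<omega>. cmod (herm_dot c (u \<omega>)) * cmod (herm_dot d (u \<omega>)))
    (pi / 4 * hyp_term ((cmod (herm_dot c d))\<^sup>2))"
proof (rule has_bochner_integral_nn_integral)
  let ?f = "\<lambda>\<omega>. cmod (herm_dot c (u \<omega>))" and ?g = "\<lambda>\<omega>. cmod (herm_dot d (u \<omega>))"
  define x where "x = (cmod (herm_dot c d))\<^sup>2"
  have x: "0 \<le> x" "x \<le> 1"
    using cmod_herm_dot_le[of c d] by (auto simp: x_def c d power_le_one)
  show nonneg: "0 \<le> pi / 4 * hyp_term ((cmod (herm_dot c d))\<^sup>2)"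
    using hyp_term_nonneg[OF x] by (simp add: x_def)
  interpret P: pair_sigma_finite M lborel ..
  let ?K = "\<lambda>r t \<omega>. laplace_kernel (?f \<omega>) r * laplace_kernel (?g \<omega>) t"
  have "ennreal pi * (\<integral>\<^sup>+\<omega>. ennreal (?f \<omega> * ?g \<omega>) \<partial>M) =
      (\<integral>\<^sup>+\<omega>. ennreal (sqrt pi * ?f \<omega>) * ennreal (sqrt pi * ?g \<omega>) \<partial>M)"
  proof -
    have "sqrt pi * a * (sqrt pi * b) = (sqrt pi * sqrt pi) * (a * b)" for a b
      by (simp only: ac_simps)
    then have sq: "sqrt pi * a * (sqrt pi * b) = pi * (a * b)" for a b by simp
    have "ennreal (sqrt pi * ?f \<omega>) * ennreal (sqrt pi * ?g \<omega>) = ennreal pi * ennreal (?f \<omega> * ?g \<omega>)" for \<omega>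
      by (subst (1 2) ennreal_mult'[symmetric]) (simp_all only: sq, simp_all)
    then show ?thesis by (simp only:) (simp add: nn_integral_cmult)
  qed
  also have "\<dots> = (\<integral>\<^sup>+\<omega>. (\<integral>\<^sup>+r. \<integral>\<^sup>+t. ennreal (?K r t \<omega>) * indicator {0..} t * indicator {0..} r \<partial>lborel \<partial>lborel) \<partial>M)"
  proof (rule nn_integral_cong)
    fix \<omega>
    have "ennreal (sqrt pi * ?f \<omega>) * ennreal (sqrt pi * ?g \<omega>) =
        (\<integral>\<^sup>+r. (ennreal (laplace_kernel (?f \<omega>) r) * indicator {0..} r) *
          (\<integral>\<^sup>+t. ennreal (laplace_kernel (?g \<omega>) t) * indicator {0..} t \<partial>lborel) \<partial>lborel)"
      by (subst nn_integral_multc) (simp_all add: nn_integral_laplace_kernel)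
    also have "\<dots> = (\<integral>\<^sup>+r. \<integral>\<^sup>+t. (ennreal (laplace_kernel (?f \<omega>) r) * indicator {0..} r) *
          (ennreal (laplace_kernel (?g \<omega>) t) * indicator {0..} t) \<partial>lborel \<partial>lborel)"
      by (intro nn_integral_cong nn_integral_cmult[symmetric]) simp
    finally show "ennreal (sqrt pi * ?f \<omega>) * ennreal (sqrt pi * ?g \<omega>) =
        (\<integral>\<^sup>+r. \<integral>\<^sup>+t. ennreal (?K r t \<omega>) * indicator {0..} t * indicator {0..} r \<partial>lborel \<partial>lborel)"
      by (simp add: ennreal_mult' laplace_kernel_nonneg ac_simps)
  qed
  also have "\<dots> = (\<integral>\<^sup>+r. \<integral>\<^sup>+\<omega>. (\<integral>\<^sup>+t. ennreal (?K r t \<omega>) * indicator {0..} t * indicator {0..} r \<partial>lborel) \<partial>M \<partial>lborel)"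
    by (rule P.Fubini'[symmetric]) measurable
  also have "\<dots> = (\<integral>\<^sup>+r. \<integral>\<^sup>+t. (\<integral>\<^sup>+\<omega>. ennreal (?K r t \<omega>) * indicator {0..} t * indicator {0..} r \<partial>M) \<partial>lborel \<partial>lborel)"
    by (intro nn_integral_cong P.Fubini'[symmetric]) measurable
  also have "\<dots> = (\<integral>\<^sup>+r. \<integral>\<^sup>+t. ennreal ((1 - 1 / (1 + r\<^sup>2) - 1 / (1 + t\<^sup>2) +
      1 / ((1 + r\<^sup>2) * (1 + t\<^sup>2) - r\<^sup>2 * t\<^sup>2 * x)) / (r\<^sup>2 * t\<^sup>2)) * indicator {0..} t * indicator {0..} r
      \<partial>lborel \<partial>lborel)"
  proof (intro nn_integral_cong)
    fix r t :: real
    let ?a = "\<lambda>\<omega>. exp (- (r\<^sup>2 * (?f \<omega>)\<^sup>2))" and ?b = "\<lambda>\<omega>. exp (- (t\<^sup>2 * (?g \<omega>)\<^sup>2))"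
    have int: "integrable M ?a" "integrable M ?b" "integrable M (\<lambda>\<omega>. ?a \<omega> * ?b \<omega>)"
      by (rule integrable_const_bound[where B = 1]; auto simp: mult_le_one)+
    \<comment> \<open>The product of the two numerators expands into four terms, each with a known
      Laplace transform.\<close>
    have K: "?K r t \<omega> = (1 - ?a \<omega> - ?b \<omega> + ?a \<omega> * ?b \<omega>) / (r\<^sup>2 * t\<^sup>2)" for \<omega>
      by (simp add: laplace_kernel_def algebra_simps)
    have "(\<integral>\<^sup>+\<omega>. ennreal (?K r t \<omega>) \<partial>M) = ennreal (expectation (?K r t))"
      by (rule nn_integral_eq_integral, unfold K) (use int in auto, auto simp: laplace_kernel_nonneg simp flip: K)
    also have "expectation (?K r t) = (1 - 1 / (1 + r\<^sup>2) - 1 / (1 + t\<^sup>2) +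
        1 / ((1 + r\<^sup>2) * (1 + t\<^sup>2) - r\<^sup>2 * t\<^sup>2 * x)) / (r\<^sup>2 * t\<^sup>2)"
      unfolding K
      using int expectation_laplace[of "r\<^sup>2" c] expectation_laplace[of "t\<^sup>2" d] expectation_laplace_pair[of "r\<^sup>2" "t\<^sup>2" c d]
      by (simp add: c d prob_space x_def)
    finally show "(\<integral>\<^sup>+\<omega>. ennreal (?K r t \<omega>) * indicator {0..} t * indicator {0..} r \<partial>M) =
      ennreal ((1 - 1 / (1 + r\<^sup>2) - 1 / (1 + t\<^sup>2) +
      1 / ((1 + r\<^sup>2) * (1 + t\<^sup>2) - r\<^sup>2 * t\<^sup>2 * x)) / (r\<^sup>2 * t\<^sup>2)) * indicator {0..} t * indicator {0..} r"
      by (simp add: nn_integral_multc)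
  qed
  also have "\<dots> = ennreal (pi\<^sup>2 / 4 * hyp_term x)"
    by (rule nn_integral_lap_series[OF x])
  also have "\<dots> = ennreal pi * ennreal (pi / 4 * hyp_term x)"
    using nonneg by (subst ennreal_mult[symmetric]) (simp_all add: x_def power2_eq_square mult.assoc)
  finally show "(\<integral>\<^sup>+\<omega>. ennreal (?f \<omega> * ?g \<omega>) \<partial>M) = ennreal (pi / 4 * hyp_term ((cmod (herm_dot c d))\<^sup>2))"
    unfolding x_def by (subst (asm) ennreal_mult_cancel_left) auto
qed auto

end

section \<open>Transfer of independence, and the channel in closed form\<close>

lemma borel_measurable_herm_dot_right[measurable]: "herm_dot c \<in> borel_measurable borel"
  unfolding herm_dot_def[abs_def] by (intro borel_measurable_continuous_onI continuous_intros)

text \<open>The preimage families in \<open>indep_vectors\<close> are already sigma-algebras and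
  contain those generated by the scalar functions; independence passes to subfamilies.\<close>

lemma (in prob_space) indep_var_of_indep_vectors:
  fixes f :: "complex ^ 'm \<Rightarrow> real" and g :: "complex ^ 'n \<Rightarrow> real"
  assumes indep: "indep_vectors M u v"
    and [measurable]: "f \<in> borel_measurable borel" "g \<in> borel_measurable borel"
  shows "indep_var borel (\<lambda>\<omega>. f (u \<omega>)) borel (\<lambda>\<omega>. g (v \<omega>))"
proof -
  define U where "U = {u -` B \<inter> space M | B. B \<in> sets borel}"
  define V where "V = {v -` B \<inter> space M | B. B \<in> sets borel}"
  have ind: "indep_set U V" using indep by (simp add: indep_vectors_def U_def V_def)
  \<comment> \<open>Independence of set families includes that their members are events, and this
    supplies measurability of \<open>u\<close> and \<open>v\<close>.\<close>
  then have ev: "U \<subseteq> events" "V \<subseteq> events" by (auto dest: indep_setD_ev1 indep_setD_ev2)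
  have [measurable]: "u \<in> borel_measurable M" "v \<in> borel_measurable M"
    using ev by (auto intro!: measurableI simp: U_def V_def)
  have "sigma_sets (space M) {(\<lambda>\<omega>. f (u \<omega>)) -` A \<inter> space M | A. A \<in> sets borel} \<subseteq> U"
  proof -
    have "U = sets (vimage_algebra (space M) u borel)"
      by (simp add: U_def sets_vimage_algebra2)
    moreover have "{(\<lambda>\<omega>. f (u \<omega>)) -` A \<inter> space M | A. A \<in> sets borel} \<subseteq> U"
      unfolding U_def using measurable_sets_borel[OF assms(2)] by (force simp: vimage_def)
    ultimately show ?thesis
      using sets.sigma_sets_subset[of _ "vimage_algebra (space M) u borel"] by simp
  qed
  moreover have "sigma_sets (space M) {(\<lambda>\<omega>. g (v \<omega>)) -` A \<inter> space M | A. A \<in> sets borel} \<subseteq> V"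
  proof -
    have "V = sets (vimage_algebra (space M) v borel)"
      by (simp add: V_def sets_vimage_algebra2)
    moreover have "{(\<lambda>\<omega>. g (v \<omega>)) -` A \<inter> space M | A. A \<in> sets borel} \<subseteq> V"
      unfolding V_def using measurable_sets_borel[OF assms(3)] by (force simp: vimage_def)
    ultimately show ?thesis
      using sets.sigma_sets_subset[of _ "vimage_algebra (space M) v borel"] by simp
  qed
  ultimately have "indep_set (sigma_sets (space M) {(\<lambda>\<omega>. f (u \<omega>)) -` A \<inter> space M | A. A \<in> sets borel})
      (sigma_sets (space M) {(\<lambda>\<omega>. g (v \<omega>)) -` A \<inter> space M | A. A \<in> sets borel})"
    using ind unfolding indep_set_def by (elim indep_sets_mono_sets) (auto split: bool.split)
  then show ?thesis unfolding indep_var_eq by simp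
qed

lemma diag_mat_mult_vector: "diag_mat v *v x = (\<chi> i. v $ i * x $ i)"
  by (simp add: diag_mat_def matrix_vector_mult_def vec_eq_iff if_distrib[of "\<lambda>a. a * _"] cong: if_cong)

lemma mat_mult_vector: "mat c *v x = c *s x" for x :: "complex ^ 'n"
  by (simp add: mat_def matrix_vector_mult_def vec_eq_iff if_distrib[of "\<lambda>a. a * _"] cong: if_cong)

lemma herm_outer_mult_vector: "herm_outer a b *v x = herm_dot b x *s a"
  by (simp add: herm_outer_def herm_dot_def matrix_vector_mult_def vec_eq_iff sum_distrib_right sum_distrib_left ac_simps)

lemma scaleR_matrix_mult_vector: "(r *\<^sub>R A) *v x = r *\<^sub>R (A *v x)" for A :: "complex ^ 'n ^ 'm"
  by (simp add: matrix_vector_mult_def vec_eq_iff scaleR_sum_right)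

lemma cis_minus_Arg_mult: "cis (- Arg z) * z = complex_of_real (cmod z)"
proof -
  have "cis (- Arg z) * (complex_of_real (cmod z) * cis (Arg z)) = complex_of_real (cmod z) * cis (- Arg z + Arg z)"
    by (simp only: mult.left_commute cis_mult)
  also have "complex_of_real (cmod z) * cis (Arg z) = z"
    using rcis_cmod_Arg[of z] by (simp add: rcis_def)
  finally show ?thesis by simp
qed

lemma cnj_mult_cis_Arg:
  assumes "cmod z = 1"
  shows "cnj z * cis (Arg z) = 1"
proof -
  have "cis (Arg z) = z" using rcis_cmod_Arg[of z] assms by (simp add: rcis_def)
  then show ?thesis using assms by (simp add: mult.commute complex_norm_square[symmetric])
qed

text \<open>The diagonal phases cancel those of \<open>g\<close> and of the conjugated
  \<open>a_r\<close>, so the reflected contributions add up as moduli. The identity includes the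
  case \<open>herm_dot a_b h = 0\<close>, where the common phase is 0.\<close>

lemma global_channel_ris_phase:
  fixes a_b h :: "complex ^ 'm" and a_r g :: "complex ^ 'n"
  assumes "\<And>i. cmod (a_r $ i) = 1"
  shows "global_channel h (los_channel \<beta> a_b a_r) (ris_phase a_b a_r h g) g =
    h + (sqrt \<beta> * (\<Sum>n\<in>UNIV. cmod (g $ n))) *\<^sub>R ((herm_dot a_b h / complex_of_real (cmod (herm_dot a_b h))) *s a_b)"
proof -
  define \<psi> where "\<psi> = herm_dot a_b h / complex_of_real (cmod (herm_dot a_b h))"
  have "ris_phase a_b a_r h g *v g = \<psi> *s (\<chi> n. cis (Arg (a_r $ n)) * complex_of_real (cmod (g $ n)))"
    by (simp add: ris_phase_def diag_mat_mult_vector mat_mult_vector cis_minus_Arg_mult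
        flip: \<psi>_def matrix_vector_mul_assoc)
  moreover have "herm_dot a_r (\<chi> n. cis (Arg (a_r $ n)) * complex_of_real (cmod (g $ n))) =
      complex_of_real (\<Sum>n\<in>UNIV. cmod (g $ n))"
    by (simp add: herm_dot_def cnj_mult_cis_Arg assms flip: mult.assoc)
  ultimately have "herm_dot a_r (ris_phase a_b a_r h g *v g) = \<psi> * complex_of_real (\<Sum>n\<in>UNIV. cmod (g $ n))"
    by (simp add: herm_dot_scale_right)
  then have "(los_channel \<beta> a_b a_r ** ris_phase a_b a_r h g) *v g =
      sqrt \<beta> *\<^sub>R ((\<psi> * complex_of_real (\<Sum>n\<in>UNIV. cmod (g $ n))) *s a_b)"
    by (simp add: los_channel_def scaleR_matrix_mult_vector herm_outer_mult_vector
        flip: matrix_vector_mul_assoc)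
  also have "\<dots> = (sqrt \<beta> * (\<Sum>n\<in>UNIV. cmod (g $ n))) *\<^sub>R (\<psi> *s a_b)"
    by (simp add: vec_eq_iff scaleR_conv_of_real[where 'a = complex])
  finally show ?thesis by (simp add: global_channel_def \<psi>_def)
qed

text \<open>The common phase turns the cross term into the modulus of \<open>herm_dot a h\<close>;
  it has modulus 1 precisely because that number is nonzero.\<close>

lemma herm_dot_aligned:
  fixes a h :: "complex ^ 'n"
  assumes "herm_dot a h \<noteq> 0"
  shows "Re (herm_dot (h + r *\<^sub>R ((herm_dot a h / complex_of_real (cmod (herm_dot a h))) *s a))
      (h + r *\<^sub>R ((herm_dot a h / complex_of_real (cmod (herm_dot a h))) *s a))) =
    (norm h)\<^sup>2 + 2 * r * cmod (herm_dot a h) + r\<^sup>2 * (norm a)\<^sup>2"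
proof -
  define \<psi> where "\<psi> = herm_dot a h / complex_of_real (cmod (herm_dot a h))"
  have \<psi>: "cmod \<psi> = 1" using assms by (simp add: \<psi>_def norm_divide)
  have "\<psi> = herm_dot a h /\<^sub>R cmod (herm_dot a h)"
    by (simp add: \<psi>_def scaleR_conv_of_real divide_inverse mult.commute)
  then have "\<psi> \<bullet> herm_dot a h = cmod (herm_dot a h)"
    using assms by (simp add: dot_square_norm power2_eq_square)
  then have "(\<psi> *s a) \<bullet> h = cmod (herm_dot a h)"
    by (simp add: inner_scale_left)
  moreover have "norm (\<psi> *s a) = norm a" by (simp add: norm_scale \<psi>)
  moreover have "(norm (h + y))\<^sup>2 = (norm h)\<^sup>2 + 2 * (y \<bullet> h) + (norm y)\<^sup>2" for y
    by (simp add: power2_norm_eq_inner inner_add_left inner_add_right inner_commute)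
  moreover have "Re (herm_dot y y) = (norm y)\<^sup>2" for y :: "complex ^ 'n"
    by (simp add: herm_dot_self)
  ultimately show ?thesis
    unfolding \<psi>_def[symmetric] by (simp add: power_mult_distrib mult.assoc)
qed

section \<open>The expected SNR\<close>

text \<open>Turns each channel entry into a linear form of the Gaussian vector, to which the moment
  formulas apply.\<close>

lemma component_hermitian_mult:
  assumes "hermitian S"
  shows "(S *v x) $ i = herm_dot (S *v axis i 1) x"
  using assms by (simp add: herm_dot_adjoint herm_dot_axis)

text \<open>Moving one root across the form leaves its square. Diagonal entries then normalise the
  columns, and off-diagonal ones are the correlations.\<close>

lemma herm_dot_columns_psd_sqrt:
  assumes "herm_psd R"
  shows "herm_dot (psd_sqrt R *v axis i 1) (psd_sqrt R *v axis j 1) = R $ i $ j"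
  using psd_sqrt_works[OF assms]
  by (simp add: herm_dot_adjoint herm_psd_def matrix_vector_mul_assoc herm_dot_axis matrix_vector_mult_axis)

lemma norm_column_psd_sqrt:
  assumes "correlation_matrix R"
  shows "norm (psd_sqrt R *v axis i 1) = 1"
proof -
  have "complex_of_real ((norm (psd_sqrt R *v axis i 1))\<^sup>2) = 1"
    using assms by (simp add: correlation_matrix_def herm_dot_columns_psd_sqrt del: of_real_power flip: herm_dot_self)
  then have "(norm (psd_sqrt R *v axis i 1))\<^sup>2 = 1"
    by (simp only: of_real_eq_1_iff)
  then show ?thesis
    using norm_ge_zero[of "psd_sqrt R *v axis i 1"] unfolding power2_eq_1_iff by linarith
qed

lemma norm_square_vec: "(norm x)\<^sup>2 = (\<Sum>i\<in>UNIV. (cmod (x $ i))\<^sup>2)" for x :: "complex ^ 'n"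
  by (simp add: norm_vec_def L2_set_def sum_nonneg)

theorem theorem1:
  fixes P :: "'a measure"
    and \<beta>_d \<beta>_br \<beta>_ru \<tau> :: real
    and R_d :: "complex ^ 'm ^ 'm" and R_ru :: "complex ^ 'n ^ 'n"
    and a_b :: "complex ^ 'm" and a_r :: "complex ^ 'n"
    and u_d :: "'a \<Rightarrow> complex ^ 'm" and u_ru :: "'a \<Rightarrow> complex ^ 'n"
  assumes "prob_space P"
    and "\<beta>_d > 0" "\<beta>_br > 0" "\<beta>_ru > 0" "\<tau> > 0"
    and "correlation_matrix R_d" "correlation_matrix R_ru"
    and "\<And>i. cmod (a_b $ i) = 1" "\<And>i. cmod (a_r $ i) = 1"
    and "psd_sqrt R_d *v a_b \<noteq> 0"
    and "std_complex_gaussian P u_d" "std_complex_gaussian P u_ru"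
    and "indep_vectors P u_d u_ru"
  defines "M \<equiv> real CARD('m)" and "N \<equiv> real CARD('n)"
  defines "A \<equiv> norm (psd_sqrt R_d *v a_b)"
  defines "F \<equiv> (\<Sum>i\<in>UNIV. \<Sum>j\<in>UNIV - {i}. pi / 4 * hyp_term ((cmod (R_ru $ i $ j))\<^sup>2))"
  shows "prob_space.expectation P
           (\<lambda>\<omega>. optimal_snr \<beta>_d \<beta>_br \<beta>_ru \<tau> R_d R_ru a_b a_r (u_d \<omega>) (u_ru \<omega>)) =
         (\<beta>_d * M + N * A * pi * sqrt (\<beta>_d * \<beta>_br * \<beta>_ru) / 2 + \<beta>_br * \<beta>_ru * M * (N + F)) * \<tau>"
proof -
  interpret prob_space P by (rule assms(1))
  interpret D: complex_gaussian_vector P u_d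
    by unfold_locales (rule assms(11))
  interpret U: complex_gaussian_vector P u_ru
    by unfold_locales (rule assms(12))
  have Rd: "herm_psd R_d" and Rr: "herm_psd R_ru"
    using assms(6,7) by (simp_all add: correlation_matrix_def)
  note hd = psd_sqrt_works(1)[OF Rd, unfolded herm_psd_def, THEN conjunct1]
    and hr = psd_sqrt_works(1)[OF Rr, unfolded herm_psd_def, THEN conjunct1]
  define c where "c i = psd_sqrt R_d *v axis i 1" for i
  define w where "w i = psd_sqrt R_ru *v axis i 1" for i
  \<comment> \<open>By self-adjointness of the root, a_b^H h_d is \<open>sqrt \<beta>_d\<close>
    times the linear form of \<open>u_d\<close> with this vector, whose norm is
    \<open>A\<close>.\<close>
  define a where "a = psd_sqrt R_d *v a_b"
  define X where "X \<omega> = (\<Sum>i\<in>UNIV. (cmod (herm_dot (c i) (u_d \<omega>)))\<^sup>2)" for \<omega>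
  define Z where "Z \<omega> = cmod (herm_dot a (u_d \<omega>))" for \<omega>
  define Y where "Y \<omega> = (\<Sum>n\<in>UNIV. cmod (herm_dot (w n) (u_ru \<omega>)))" for \<omega>
  have nc: "norm (c i) = 1" for i unfolding c_def by (rule norm_column_psd_sqrt) fact
  have nw: "norm (w i) = 1" for i unfolding w_def by (rule norm_column_psd_sqrt) fact
  have nab: "(norm a_b)\<^sup>2 = M" using assms(8) by (simp add: norm_square_vec M_def)

  have X: "has_bochner_integral P X M"
  proof -
    have "has_bochner_integral P X (\<Sum>i\<in>(UNIV :: 'm set). (norm (c i))\<^sup>2)"
      unfolding X_def
      by (intro has_bochner_integral_sum)
        (simp add: has_bochner_integral_iff D.integrable_cmod_square D.expectation_cmod_square)
    then show ?thesis by (simp add: nc M_def)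
  qed
  have Z: "has_bochner_integral P Z (A * sqrt pi / 2)"
    unfolding Z_def A_def a_def by (rule D.has_bochner_integral_cmod)
  have Y: "has_bochner_integral P Y (N * (sqrt pi / 2))"
  proof -
    have "has_bochner_integral P Y (\<Sum>n\<in>(UNIV :: 'n set). sqrt pi / 2)"
      unfolding Y_def by (intro has_bochner_integral_sum U.has_bochner_integral_cmod_unit nw)
    then show ?thesis by (simp add: N_def)
  qed
  have YZ: "has_bochner_integral P (\<lambda>\<omega>. Z \<omega> * Y \<omega>) (A * sqrt pi / 2 * (N * (sqrt pi / 2)))"
  proof -
    \<comment> \<open>The only use of independence of the two links: the cross term
      factorises.\<close>
    have indep: "indep_var borel Z borel Y"
      unfolding Z_def[abs_def] Y_def[abs_def] by (rule indep_var_of_indep_vectors[OF assms(13)]) measurable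
    have int: "integrable P Z" "integrable P Y"
      using Y Z by (auto simp: has_bochner_integral_iff)
    show ?thesis
      by (simp only: has_bochner_integral_iff indep_var_integrable[OF indep int]
          indep_var_lebesgue_integral[OF indep int] has_bochner_integral_integral_eq[OF Y]
          has_bochner_integral_integral_eq[OF Z])
  qed
  have Y2: "has_bochner_integral P (\<lambda>\<omega>. (Y \<omega>)\<^sup>2) (N + F)"
  proof -
    have inner: "cmod (herm_dot (w i) (w j)) = cmod (R_ru $ i $ j)" for i j
      unfolding w_def by (simp add: herm_dot_columns_psd_sqrt[OF Rr])
    \<comment> \<open>Diagonal terms of the squared sum are second moments equal to 1 and give
      \<open>N\<close>; the others give \<open>F\<close>.\<close>
    define e where "e i j = (if i = j then 1 else pi / 4 * hyp_term ((cmod (R_ru $ i $ j))\<^sup>2))" for i j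
    have "has_bochner_integral P (\<lambda>\<omega>. cmod (herm_dot (w i) (u_ru \<omega>)) * cmod (herm_dot (w j) (u_ru \<omega>))) (e i j)" for i j
    proof (cases "i = j")
      case True
      then show ?thesis
        using U.integrable_cmod_square[of "w i"] U.expectation_cmod_square[of "w i"]
        by (simp add: e_def has_bochner_integral_iff nw power2_eq_square)
    next
      case False
      then show ?thesis
        using U.has_bochner_integral_cmod_pair[OF nw nw, of i j] by (simp add: e_def inner)
    qed
    then have "has_bochner_integral P
        (\<lambda>\<omega>. \<Sum>i\<in>UNIV. \<Sum>j\<in>UNIV. cmod (herm_dot (w i) (u_ru \<omega>)) * cmod (herm_dot (w j) (u_ru \<omega>)))
        (\<Sum>i\<in>UNIV. \<Sum>j\<in>UNIV. e i j)"
      by (intro has_bochner_integral_sum)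
    moreover have "(\<Sum>i\<in>UNIV. \<Sum>j\<in>UNIV. e i j) = N + F"
    proof -
      have "(\<Sum>j\<in>UNIV. e i j) = 1 + (\<Sum>j\<in>UNIV - {i}. pi / 4 * hyp_term ((cmod (R_ru $ i $ j))\<^sup>2))" for i
        by (subst sum.remove[of _ i]) (auto simp: e_def intro!: sum.cong)
      then show ?thesis by (simp add: N_def F_def sum.distrib)
    qed
    ultimately show ?thesis by (simp add: Y_def power2_eq_square sum_product)
  qed

  let ?S = "\<lambda>\<omega>. optimal_snr \<beta>_d \<beta>_br \<beta>_ru \<tau> R_d R_ru a_b a_r (u_d \<omega>) (u_ru \<omega>)"
  let ?T = "\<lambda>\<omega>. (\<beta>_d * X \<omega> + 2 * sqrt (\<beta>_d * \<beta>_br * \<beta>_ru) * (Z \<omega> * Y \<omega>) + \<beta>_br * \<beta>_ru * M * (Y \<omega>)\<^sup>2) * \<tau>"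
  \<comment> \<open>On the null event \<open>a\<^sub>b\<^sup>H h\<^sub>d = 0\<close> the phase \<open>\<psi>\<close> is \<open>0 / 0 = 0\<close>.\<close>
  have snr: "?S \<omega> = (if herm_dot a (u_d \<omega>) = 0 then \<beta>_d * X \<omega> * \<tau> else ?T \<omega>)" for \<omega>
  proof -
    define h where "h = rayleigh_channel \<beta>_d R_d (u_d \<omega>)"
    define g where "g = rayleigh_channel \<beta>_ru R_ru (u_ru \<omega>)"
    have dot: "herm_dot a_b h = sqrt \<beta>_d *\<^sub>R herm_dot a (u_d \<omega>)"
      by (simp add: h_def rayleigh_channel_def herm_dot_scaleR_right a_def herm_dot_adjoint[OF hd])
    then have dot_0: "herm_dot a_b h = 0 \<longleftrightarrow> herm_dot a (u_d \<omega>) = 0" using assms(2) by simp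
    have cdot: "cmod (herm_dot a_b h) = sqrt \<beta>_d * Z \<omega>"
      using assms(2) by (simp add: dot Z_def)
    have "(norm h)\<^sup>2 = (\<Sum>i\<in>UNIV. (sqrt \<beta>_d)\<^sup>2 * (cmod (herm_dot (c i) (u_d \<omega>)))\<^sup>2)"
      unfolding norm_square_vec
      by (intro sum.cong) (simp_all add: h_def rayleigh_channel_def component_hermitian_mult[OF hd] c_def power_mult_distrib)
    then have nh: "(norm h)\<^sup>2 = \<beta>_d * X \<omega>"
      using assms(2) by (simp add: X_def sum_distrib_left)
    have gn: "(\<Sum>n\<in>UNIV. cmod (g $ n)) = sqrt \<beta>_ru * Y \<omega>"
      using assms(4)
      by (simp add: g_def rayleigh_channel_def component_hermitian_mult[OF hr] w_def Y_def sum_distrib_left)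
    have S: "?S \<omega> = Re (herm_dot (global_channel h (los_channel \<beta>_br a_b a_r) (ris_phase a_b a_r h g) g)
        (global_channel h (los_channel \<beta>_br a_b a_r) (ris_phase a_b a_r h g) g)) * \<tau>"
      by (simp add: optimal_snr_def Let_def h_def g_def)
    show ?thesis
    proof (cases "herm_dot a (u_d \<omega>) = 0")
      case True
      then have "herm_dot a_b h = 0" by (simp add: dot_0)
      then have "?S \<omega> = (norm h)\<^sup>2 * \<tau>"
        unfolding S global_channel_ris_phase[OF assms(9)] by (simp add: herm_dot_self)
      with True show ?thesis by (simp add: nh)
    next
      case False
      then have nz: "herm_dot a_b h \<noteq> 0" by (simp add: dot_0)
      have "?S \<omega> = (\<beta>_d * X \<omega> + 2 * (sqrt \<beta>_br * (sqrt \<beta>_ru * Y \<omega>)) * (sqrt \<beta>_d * Z \<omega>)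
          + (sqrt \<beta>_br * (sqrt \<beta>_ru * Y \<omega>))\<^sup>2 * M) * \<tau>"
        unfolding S global_channel_ris_phase[OF assms(9)] herm_dot_aligned[OF nz]
        unfolding nh cdot gn nab ..
      also have "\<dots> = ?T \<omega>"
        using assms(3,4) by (simp add: power_mult_distrib real_sqrt_mult ac_simps)
      finally show ?thesis using False by simp
    qed
  qed
  have T: "has_bochner_integral P ?T ((\<beta>_d * M +
      2 * sqrt (\<beta>_d * \<beta>_br * \<beta>_ru) * (A * sqrt pi / 2 * (N * (sqrt pi / 2))) + \<beta>_br * \<beta>_ru * M * (N + F)) * \<tau>)"
    by (intro has_bochner_integral_mult_left has_bochner_integral_add has_bochner_integral_mult_right X YZ Y2)
  have "expectation ?S = expectation ?T"
  proof (rule integral_cong_AE)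
    have [measurable]: "X \<in> borel_measurable P" and [measurable]: "?T \<in> borel_measurable P"
      using X T by (auto dest: borel_measurable_has_bochner_integral)
    show "?T \<in> borel_measurable P" by measurable
    \<comment> \<open>The pointwise formula \<open>snr\<close>, valid on the null event as well,
      bypasses measurability of the entrywise phases.\<close>
    show "?S \<in> borel_measurable P" unfolding snr by measurable
    have "AE \<omega> in P. herm_dot a (u_d \<omega>) \<noteq> 0"
      using assms(10) unfolding a_def by (rule D.AE_herm_dot_nonzero)
    then show "AE \<omega> in P. ?S \<omega> = ?T \<omega>"
    proof eventually_elim
      case (elim \<omega>)
      then show ?case unfolding snr by simp
    qed
  qed
  also have "\<dots> = (\<beta>_d * M +
      2 * sqrt (\<beta>_d * \<beta>_br * \<beta>_ru) * (A * sqrt pi / 2 * (N * (sqrt pi / 2))) + \<beta>_br * \<beta>_ru * M * (N + F)) * \<tau>"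
    using T by (rule has_bochner_integral_integral_eq)
  also have "2 * sqrt (\<beta>_d * \<beta>_br * \<beta>_ru) * (A * sqrt pi / 2 * (N * (sqrt pi / 2))) =
      N * A * pi * sqrt (\<beta>_d * \<beta>_br * \<beta>_ru) / 2"
  proof -
    have "2 * r * (A * q / 2 * (N * (q / 2))) = N * A * (q * q) * r / 2" for r q by simp
    then show ?thesis by simp
  qed
  finally show ?thesis .
qed

end
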